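(* Let $\mathcal{H}$ be a separable Hilbert space with orthonormal basis $(e_n)_{n\in\mathbb{N}}$, $P_n$ the orthogonal projection onto $\operatorname{span}\{e_1,\dots,e_n\}$, $T>0$ and $x_0\in\mathcal{H}$. Let $F\colon[0,T]\times\mathcal{H}\rightrightarrows\mathcal{H}$ have nonempty, closed, convex values and satisfy: (F1) for each $v\in\mathcal{H}$, $F(\cdot,v)$ is measurable; (F2) for a.e. $t$, $F(t,\cdot)$ is upper semicontinuous from $\mathcal{H}$ into $\mathcal{H}_w$; (F3) there exist integrable $c,d\colon[0,T]\to\mathbb{R}_+$ with $\inf\{\|w\|\colon w\in F(t,v)\}\le c(t)\|v\|+d(t)$ for all $v\in\mathcal{H}$ and a.e. $t$. Let $g\colon[0,T]\times[0,T]\times\mathcal{H}\to\mathcal{H}$ satisfy: (g1) for each $v\in\mathcal{H}$, $(t,s)\mapsto g(t,s,v)$ is measurable; (g2) for every $r>0$ there is an integrable $\mu_r\colon[0,T]\to\mathbb{R}_+$ with $\|g(t,s,x)-g(t,s,y)\|\le\mu_r(t)\|x-y\|$ for all $(t,s)\in D$ and $x,y\in r\mathbb{B}$, where $D=\{(t,s)\in[0,T]^2\colon s\le t\}$; (g3) there is a nonnegative integrable $\sigma\colon D\to\mathbb{R}$ with $\|g(t,s,x)\|\le\sigma(t,s)(1+\|x\|)$ for all $(t,s)\in D$, $x\in\mathcal{H}$. Then for each $n\in\mathbb{N}$ the problem $$\dot x(t)\in F(t,P_n(x(t)))+\int_0^tg(t,s,P_n(x(s)))\,ds\ \text{ a.e.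 } t\in[0,T],\qquad x(0)=P_n(x_0),$$ admits at least one solution $x_n\in\operatorname{AC}([0,T];\mathcal{H})$. Moreover $\|x_n(t)\|\le r(t)$ for all $t\in[0,T]$, where $$r(t):=\|x_0\|e(t,0)+\int_0^t\left(d(s)+\int_0^s\sigma(s,\tau)d\tau\right)e(t,s)\,ds,\quad e(t_2,t_1):=\exp\left(\int_{t_1}^{t_2}\Big(c(s)+\int_0^s\sigma(s,\tau)d\tau\Big)ds\right),$$ and for a.e. $t\in[0,T]$, $$\|\dot x_n(t)\|\le\psi(t):=c(t)r(t)+d(t)+\int_0^t\sigma(t,s)\,ds+\int_0^t\sigma(t,s)r(s)\,ds.$$
   Context: $\mathbb{B}$ is the closed unit ball, $\mathcal{H}_w$ is $\mathcal{H}$ with the weak topology. $\operatorname{AC}([0,T];\mathcal{H})$ is the set of functions $u(t)=u_0+\int_0^tf(s)ds$ with $u_0\in\mathcal{H}$ and $f\in L^1([0,T];\mathcal{H})$ (Bochner integral). A solution is an absolutely continuous function satisfying the inclusion for a.e. $t$ and the initial condition. *)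

theory Defs
  imports "HOL-Analysis.Analysis"
begin

definition weak_topology :: "'a::real_inner topology" where
  "weak_topology = topology_generated_by {{x. x \<bullet> y \<in> V} | y V. open V}"

definition usc_weak :: "('a::real_inner \<Rightarrow> 'a set) \<Rightarrow> bool" where
  "usc_weak G \<longleftrightarrow> (\<forall>v W. openin weak_topology W \<and> G v \<subseteq> W \<longrightarrow>
      (\<exists>\<delta>>0. \<forall>u. dist u v < \<delta> \<longrightarrow> G u \<subseteq> W))"

definition measurable_multifun :: "'b measure \<Rightarrow> ('b \<Rightarrow> 'a::topological_space set) \<Rightarrow> bool" where
  "measurable_multifun M G \<longleftrightarrow> (\<forall>U. open U \<longrightarrow> {t \<in> space M. G t \<inter> U \<noteq> {}} \<in> sets M)"

definition orth_proj :: "'a::real_inner set \<Rightarrow> 'a \<Rightarrow> 'a" where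
  "orth_proj M x = (THE y. y \<in> M \<and> (\<forall>z\<in>M. (x - y) \<bullet> z = 0))"

definition AC_on :: "real \<Rightarrow> (real \<Rightarrow> 'a::{real_normed_vector, second_countable_topology}) \<Rightarrow> bool" where
  "AC_on T u \<longleftrightarrow> (\<exists>f. integrable (lebesgue_on {0..T}) f \<and>
      (\<forall>t\<in>{0..T}. u t = u 0 + integral\<^sup>L (lebesgue_on {0..t}) f))"

definition inner_sigma :: "(real \<Rightarrow> real \<Rightarrow> real) \<Rightarrow> real \<Rightarrow> real" where
  "inner_sigma \<sigma> s = integral\<^sup>L (lebesgue_on {0..s}) (\<lambda>\<tau>. \<sigma> s \<tau>)"

definition e_fun :: "(real \<Rightarrow> real) \<Rightarrow> (real \<Rightarrow> real \<Rightarrow> real) \<Rightarrow> real \<Rightarrow> real \<Rightarrow> real" where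
  "e_fun c \<sigma> t2 t1 = exp (integral\<^sup>L (lebesgue_on {t1..t2}) (\<lambda>s. c s + inner_sigma \<sigma> s))"

definition r_fun :: "real \<Rightarrow> (real \<Rightarrow> real) \<Rightarrow> (real \<Rightarrow> real) \<Rightarrow> (real \<Rightarrow> real \<Rightarrow> real) \<Rightarrow> real \<Rightarrow> real" where
  "r_fun nx0 c d \<sigma> t = nx0 * e_fun c \<sigma> t 0
     + integral\<^sup>L (lebesgue_on {0..t}) (\<lambda>s. (d s + inner_sigma \<sigma> s) * e_fun c \<sigma> t s)"

definition psi_fun :: "real \<Rightarrow> (real \<Rightarrow> real) \<Rightarrow> (real \<Rightarrow> real) \<Rightarrow> (real \<Rightarrow> real \<Rightarrow> real) \<Rightarrow> real \<Rightarrow> real" where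
  "psi_fun nx0 c d \<sigma> t = c t * r_fun nx0 c d \<sigma> t + d t + inner_sigma \<sigma> t
     + integral\<^sup>L (lebesgue_on {0..t}) (\<lambda>s. \<sigma> t s * r_fun nx0 c d \<sigma> s)"

end

theory Submission
  imports Defs "HOL-Complex_Analysis.Great_Picard"
begin

text \<open>
  Euler polygons frozen at grid points, with the minimal norm selection of \<open>F\<close> as velocity, satisfy
  \<open>\<parallel>x(t)\<parallel> \<le> r(t)\<close> because \<open>r\<close> dominates each explicit Euler step.  Their projections lie in a fixed
  finite-dimensional space and are equicontinuous, so by Arzela-Ascoli a subsequence converges pointwise
  to some \<open>y\<close>.  The selections themselves converge only weakly, but suitable convex combinations of
  tails converge almost everywhere; since closed convex sets are intersections of half-spaces, upper
  semicontinuity into the weak topology puts the limit in \<open>F(t, y(t))\<close>.  The integral terms converge by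
  dominated convergence, and integrating the limit velocity gives a curve whose projection is \<open>y\<close>.
\<close>

section \<open>Closed convex sets in Hilbert space\<close>

text \<open>The values \<open>F t v\<close> are measurable in t for each fixed v and only
  semicontinuous in v, so no joint measurability is at hand and a selection evaluated along a
  continuous curve need not be measurable. Freezing the argument at grid points makes it a step
  function with countably many values, for which measurability in t at each value suffices. The
  projection acts on the arguments of F and g only. Velocities, polygons and the solution stay in
  the infinite-dimensional space, and compactness is available only for the projected polygons. The
  unprojected limit is therefore reached by averaging with weights that do not depend on t, and one
  family of weights has to serve selections, integral terms and polygons alike. Averaging tails
  preserves limits that already exist, so the projections still tend to y, and the inclusion
  verified at y is an inclusion at the projection of the constructed curve. The right-hand side has
  memory, so the growth estimate must control the whole past at each time; it is propagated from one
  grid cell to the next.\<close>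

lemma convex_near_minimal_norm:
  fixes C :: "'h::real_inner set"
  assumes "convex C" "u \<in> C" "w \<in> C" and m: "\<And>x. x \<in> C \<Longrightarrow> m \<le> norm x" and "0 \<le> m"
    and "norm u \<le> m + \<delta>" "norm w \<le> m + \<delta>"
  shows "(norm (u - w))\<^sup>2 \<le> 4 * \<delta> * (2 * m + \<delta>)"
proof -
  \<comment> \<open>The midpoint lies in C, so \<open>norm (u + w)\<close> is at least
    \<open>2 * m\<close>. The parallelogram identity then leaves at most
    \<open>4 * (m + \<delta>)\<^sup>2 - 4 * m\<^sup>2\<close> for the difference, which is the
    stated bound.\<close>
  have "(1/2) *\<^sub>R u + (1/2) *\<^sub>R w \<in> C"
    using assms by (intro convexD) auto
  then have "m \<le> norm ((1/2) *\<^sub>R (u + w))"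
    using m by (simp add: scaleR_add_right)
  then have "2 * m \<le> norm (u + w)" by simp
  then have "(2 * m)\<^sup>2 \<le> (norm (u + w))\<^sup>2"
    using \<open>0 \<le> m\<close> by (intro power_mono) auto
  moreover have "(norm (u - w))\<^sup>2 + (norm (u + w))\<^sup>2 = 2 * (norm u)\<^sup>2 + 2 * (norm w)\<^sup>2"
    by (simp add: power2_norm_eq_inner inner_diff inner_add algebra_simps inner_commute)
  moreover have "(norm u)\<^sup>2 \<le> (m + \<delta>)\<^sup>2" "(norm w)\<^sup>2 \<le> (m + \<delta>)\<^sup>2"
    using assms by (intro power_mono; simp)+
  ultimately show ?thesis
    by (simp add: power2_eq_square algebra_simps)
qed

text \<open>A minimising sequence is Cauchy by the parallelogram estimate; completeness gives a
  limit and closedness keeps it in C.\<close>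

lemma closed_convex_minimal_norm:
  fixes C :: "'h::{real_inner, complete_space} set"
  assumes "closed C" "convex C" "C \<noteq> {}"
  obtains z where "z \<in> C" "\<And>x. x \<in> C \<Longrightarrow> norm z \<le> norm x"
proof -
  define m where "m = Inf (norm ` C)"
  have bdd: "bdd_below (norm ` C)" by (rule bdd_belowI[of _ 0]) auto
  have m: "m \<le> norm x" if "x \<in> C" for x
    unfolding m_def using that bdd by (intro cInf_lower) auto
  have m0: "0 \<le> m"
    unfolding m_def using assms by (intro cInf_greatest) auto
  have "\<exists>w\<in>C. norm w < m + 1 / Suc k" for k :: nat
    using cInf_lessD[of "norm ` C" "m + 1 / Suc k"] assms(3) unfolding m_def by auto
  then obtain w where w: "\<And>k. w k \<in> C" "\<And>k. norm (w k) < m + 1 / Suc k" by metis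
  have est: "(norm (w k - w l))\<^sup>2 \<le> 4 * (1 / Suc k) * (2 * m + 1)" if "k \<le> l" for k l
  proof -
    have "1 / real (Suc l) \<le> 1 / Suc k" using that by (intro divide_left_mono) auto
    then have "(norm (w k - w l))\<^sup>2 \<le> 4 * (1 / Suc k) * (2 * m + 1 / Suc k)"
      using w[of k] w[of l] m m0 assms(2) by (intro convex_near_minimal_norm[of C]) auto
    also have "\<dots> \<le> 4 * (1 / Suc k) * (2 * m + 1)"
      by (intro mult_left_mono add_mono) auto
    finally show ?thesis .
  qed
  have lim: "(\<lambda>k. 4 * (1 / Suc k) * (2 * m + 1)) \<longlonglongrightarrow> 4 * 0 * (2 * m + 1)"
    by (intro tendsto_intros LIMSEQ_Suc lim_1_over_n)
  have "Cauchy w"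
  proof (rule metric_CauchyI)
    fix \<epsilon> :: real assume "\<epsilon> > 0"
    then have "eventually (\<lambda>k. 4 * (1 / Suc k) * (2 * m + 1) < \<epsilon>\<^sup>2) sequentially"
      using lim by (intro order_tendstoD(2)) auto
    then obtain N where N: "\<And>k. k \<ge> N \<Longrightarrow> 4 * (1 / Suc k) * (2 * m + 1) < \<epsilon>\<^sup>2"
      unfolding eventually_sequentially by auto
    have *: "dist (w k) (w l) < \<epsilon>" if "k \<ge> N" "k \<le> l" for k l
    proof -
      have "(norm (w k - w l))\<^sup>2 < \<epsilon>\<^sup>2" using est[OF that(2)] N[OF that(1)] by linarith
      then show ?thesis using \<open>\<epsilon> > 0\<close> by (simp add: dist_norm power2_less_imp_less)
    qed
    show "\<exists>N. \<forall>k\<ge>N. \<forall>l\<ge>N. dist (w k) (w l) < \<epsilon>"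
    proof (intro exI allI impI)
      fix k l assume "k \<ge> N" "l \<ge> N"
      then show "dist (w k) (w l) < \<epsilon>"
        using *[of k l] *[of l k] by (cases "k \<le> l") (auto simp: dist_commute)
    qed
  qed
  then obtain z where z: "w \<longlonglongrightarrow> z"
    using Cauchy_convergent convergent_def by blast
  have zC: "z \<in> C" using closed_sequentially[OF assms(1)] w(1) z by blast
  have "norm z \<le> m + 0"
  proof (rule LIMSEQ_le)
    show "(\<lambda>k. norm (w k)) \<longlonglongrightarrow> norm z" using z by (rule tendsto_norm)
    show "(\<lambda>k. m + 1 / Suc k) \<longlonglongrightarrow> m + 0"
      by (intro tendsto_intros LIMSEQ_Suc lim_1_over_n)
    show "\<exists>N. \<forall>n\<ge>N. norm (w n) \<le> m + 1 / Suc n" using w(2) less_imp_le by blast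
  qed
  then show ?thesis using m zC by (intro that[of z]) fastforce+
qed

text \<open>The normal is the negative of the shortest vector z in the translate of C by
  \<open>- f\<close>. Minimality yields \<open>z \<bullet> z \<le> y \<bullet> z\<close> throughout
  the translate, and placing the level halfway leaves a strict gap on both sides.\<close>

lemma closed_convex_separate_point:
  fixes C :: "'h::{real_inner, complete_space} set"
  assumes "closed C" "convex C" "f \<notin> C"
  obtains p \<alpha> where "\<And>w. w \<in> C \<Longrightarrow> w \<bullet> p < \<alpha>" "\<alpha> < f \<bullet> p"
proof (cases "C = {}")
  case True
  then show ?thesis using that[of 0 "-1"] by auto
next
  case False
  let ?C = "(\<lambda>w. w - f) ` C"
  have eq: "?C = (\<lambda>w. - f + w) ` C" by auto
  have C: "closed ?C" "convex ?C" "?C \<noteq> {}"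
    using closed_translation[OF assms(1), of "- f"] convex_translation[OF assms(2), of "- f"] False
    unfolding eq by blast+
  obtain z where z: "z \<in> ?C" "\<And>x. x \<in> ?C \<Longrightarrow> norm z \<le> norm x"
    using closed_convex_minimal_norm[OF C] by blast
  from z(1) obtain w where "z = w - f" "w \<in> C" by (rule imageE)
  then have "z \<noteq> 0" using assms(3) by auto
  have var: "z \<bullet> z \<le> y \<bullet> z" if y: "y \<in> ?C" for y
  proof (rule ccontr)
    assume neg: "\<not> z \<bullet> z \<le> y \<bullet> z"
    define a where "a = z \<bullet> z - y \<bullet> z"
    have a: "a > 0" using neg by (simp add: a_def)
    define b where "b = (y - z) \<bullet> (y - z)"
    have b: "b \<ge> 0" by (simp add: b_def)
    \<comment> \<open>Moving from z by s towards y changes the squared norm by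
      \<open>s * s * b - 2 * s * a\<close>. Minimality forces \<open>2 * a \<le> s * b\<close>,
      which fails once \<open>s * b \<le> a\<close>; the denominator \<open>b + 1\<close> also
      covers b = 0.\<close>
    define s where "s = min 1 (a / (b + 1))"
    have s: "0 < s" "s \<le> 1" "s * (b + 1) \<le> a"
    proof -
      show "0 < s" "s \<le> 1" using a b by (auto simp: s_def)
      have "s \<le> a / (b + 1)" by (simp add: s_def)
      then show "s * (b + 1) \<le> a" using b by (simp add: pos_le_divide_eq)
    qed
    have "(1 - s) *\<^sub>R z + s *\<^sub>R y \<in> ?C"
      using \<open>convex ?C\<close> z(1) y s by (intro convexD) auto
    then have "norm z \<le> norm ((1 - s) *\<^sub>R z + s *\<^sub>R y)" by (rule z(2))
    then have "(norm z)\<^sup>2 \<le> (norm ((1 - s) *\<^sub>R z + s *\<^sub>R y))\<^sup>2" by (intro power_mono) auto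
    also have "(1 - s) *\<^sub>R z + s *\<^sub>R y = z + s *\<^sub>R (y - z)" by (simp add: algebra_simps)
    also have "(norm (z + s *\<^sub>R (y - z)))\<^sup>2 = (norm z)\<^sup>2 - 2 * s * a + s * s * b"
      by (simp add: power2_norm_eq_inner a_def b_def inner_add inner_diff algebra_simps inner_commute)
    finally have "s * (2 * a) \<le> s * (s * b)" by (simp add: algebra_simps)
    then have "2 * a \<le> s * b" using s by simp
    also have "\<dots> \<le> a" using s b by (simp add: algebra_simps)
    finally show False using a by simp
  qed
  have zz: "z \<bullet> z > 0" using \<open>z \<noteq> 0\<close> by simp
  show ?thesis
  proof (rule that[of "- z" "f \<bullet> (- z) - z \<bullet> z / 2"])
    fix w assume "w \<in> C"
    then have "z \<bullet> z \<le> (w - f) \<bullet> z" by (intro var) auto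
    then show "w \<bullet> - z < f \<bullet> - z - z \<bullet> z / 2"
      using zz unfolding inner_minus_right inner_diff_left by linarith
  qed (use zz in simp)
qed

section \<open>The element of minimal norm as a measurable selection\<close>

lemma infdist_less_iff:
  assumes "A \<noteq> {}"
  shows "infdist q A < a \<longleftrightarrow> A \<inter> ball q a \<noteq> {}"
proof -
  have "bdd_below (dist q ` A)" by (rule bdd_belowI[of _ 0]) auto
  then show ?thesis
    using assms by (auto simp: infdist_def cInf_less_iff)
qed

text \<open>The minimal element is a limit of countably valued functions. Stage k takes the first
  point of a dense sequence that is within \<open>1 / Suc k\<close> of \<open>G t\<close> and whose
  norm exceeds the minimum by less than \<open>1 / Suc k\<close>. Both tests involve only distances
  to \<open>G t\<close>, which are measurable because hits of balls are.\<close>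

lemma measurable_minimal_norm_selection:
  fixes G :: "'b \<Rightarrow> 'h::{real_inner, complete_space, second_countable_topology} set"
  assumes closed: "\<And>t. t \<in> space M \<Longrightarrow> closed (G t)"
    and convex: "\<And>t. t \<in> space M \<Longrightarrow> convex (G t)"
    and ne: "\<And>t. t \<in> space M \<Longrightarrow> G t \<noteq> {}"
    and meas: "\<And>p \<rho>. {t \<in> space M. G t \<inter> ball p \<rho> \<noteq> {}} \<in> sets M"
  obtains z where "z \<in> borel_measurable M" "\<And>t. t \<in> space M \<Longrightarrow> z t \<in> G t"
    "\<And>t. t \<in> space M \<Longrightarrow> norm (z t) = Inf (norm ` G t)"
proof -
  have "\<forall>t\<in>space M. \<exists>z. z \<in> G t \<and> (\<forall>x\<in>G t. norm z \<le> norm x)"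
    using closed_convex_minimal_norm[OF closed convex ne] by metis
  then obtain z where z: "\<And>t. t \<in> space M \<Longrightarrow> z t \<in> G t"
    "\<And>t x. t \<in> space M \<Longrightarrow> x \<in> G t \<Longrightarrow> norm (z t) \<le> norm x" by metis
  have nz: "norm (z t) = Inf (norm ` G t)" if "t \<in> space M" for t
    using z that by (intro cInf_eq_minimum[symmetric]) auto
  have mdist[measurable]: "(\<lambda>t. infdist p (G t)) \<in> borel_measurable M" for p
  proof (rule borel_measurableI_less)
    fix a
    have "{t \<in> space M. infdist p (G t) < a} = {t \<in> space M. G t \<inter> ball p a \<noteq> {}}"
      using infdist_less_iff[OF ne] by auto
    then show "{t \<in> space M. infdist p (G t) < a} \<in> sets M" using meas by simp
  qed
  have nz0: "norm (z t) = infdist 0 (G t)" if "t \<in> space M" for t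
    using nz[OF that] ne[OF that] by (simp add: infdist_def)
  obtain D :: "'h set" where D: "countable D" "\<And>X. open X \<Longrightarrow> X \<noteq> {} \<Longrightarrow> \<exists>d\<in>D. d \<in> X"
    using countable_dense_exists by auto
  then have "D \<noteq> {}" using open_UNIV by blast
  define q where "q = from_nat_into D"
  have q: "\<exists>n. q n \<in> X" if "open X" "X \<noteq> {}" for X
    using D(2)[OF that] from_nat_into_surj[OF D(1)] unfolding q_def by metis
  define Q where "Q k t n \<longleftrightarrow> infdist (q n) (G t) < 1 / Suc k \<and> norm (q n) < infdist 0 (G t) + 1 / Suc k"
    for k :: nat and t n
  have exQ: "\<exists>n. Q k t n" if "t \<in> space M" for k t
  proof -
    have "z t \<in> ball (z t) (1 / Suc k)" by simp
    then obtain n where n: "q n \<in> ball (z t) (1 / Suc k)"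
      using q[of "ball (z t) (1 / Suc k)"] by auto
    have "infdist (q n) (G t) < 1 / Suc k"
      using n z(1)[OF that] infdist_le[of "z t" "G t" "q n"] by (auto simp: dist_commute)
    moreover have "norm (q n) < norm (z t) + 1 / Suc k"
      using n norm_triangle_ineq[of "q n - z t" "z t"] by (auto simp: dist_norm norm_minus_commute)
    ultimately show ?thesis unfolding Q_def nz0[OF that] by blast
  qed
  have meas_q: "(\<lambda>t. q (LEAST n. Q k t n)) \<in> borel_measurable M" for k
    unfolding Q_def by measurable
  have lim_q: "(\<lambda>k. q (LEAST n. Q k t n)) \<longlonglongrightarrow> z t" if t: "t \<in> space M" for t
  proof -
    define m where "m = norm (z t)"
    define y where "y k = q (LEAST n. Q k t n)" for k
    have "Q k t (LEAST n. Q k t n)" for k using exQ[OF t] LeastI_ex by blast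
    then have y: "infdist (y k) (G t) < 1 / Suc k" "norm (y k) < m + 1 / Suc k" for k
      unfolding Q_def y_def m_def nz0[OF t] by auto
    have bound: "norm (y k - z t) \<le> sqrt (4 * (2 / Suc k) * (2 * m + 2 / Suc k)) + 1 / Suc k" for k
    proof -
      \<comment> \<open>The approximant \<open>y k\<close> need not lie in \<open>G t\<close>, so
        the parallelogram estimate is applied to a nearby w. Its norm exceeds m by at most
        \<open>2 / Suc k\<close>: one share for the distance, one for the excess of
        \<open>y k\<close>.\<close>
      obtain w where w: "w \<in> G t" "dist (y k) w < 1 / Suc k"
        using y(1)[of k] infdist_less_iff[OF ne[OF t]] by auto
      have "norm w \<le> norm (y k) + dist (y k) w"
        by (metis dist_norm norm_minus_commute norm_triangle_sub)
      then have nw: "norm w \<le> m + 2 / Suc k" using w(2) y(2)[of k] by simp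
      have "(norm (w - z t))\<^sup>2 \<le> 4 * (2 / Suc k) * (2 * m + 2 / Suc k)"
        using z[OF t] t w(1) nw convex by (intro convex_near_minimal_norm[of "G t"]) (auto simp: m_def)
      then have "norm (w - z t) \<le> sqrt (4 * (2 / Suc k) * (2 * m + 2 / Suc k))"
        using real_le_rsqrt by blast
      moreover have "norm (y k - z t) \<le> dist (y k) w + norm (w - z t)"
        by (metis dist_norm dist_triangle)
      ultimately show ?thesis using w(2) by linarith
    qed
    have inv: "(\<lambda>k. a / real (Suc k)) \<longlonglongrightarrow> 0" for a
      using LIMSEQ_Suc[OF lim_const_over_n[of a]] by simp
    have "(\<lambda>k. sqrt (4 * (2 / Suc k) * (2 * m + 2 / Suc k)) + 1 / Suc k) \<longlonglongrightarrow> sqrt (4 * 0 * (2 * m + 0)) + 0"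
      by (intro tendsto_intros inv)
    then have "(\<lambda>k. sqrt (4 * (2 / Suc k) * (2 * m + 2 / Suc k)) + 1 / Suc k) \<longlonglongrightarrow> 0" by simp
    then have "(\<lambda>k. y k - z t) \<longlonglongrightarrow> 0"
      by (rule Lim_null_comparison[rotated]) (use bound in simp)
    then show ?thesis unfolding y_def by (rule LIM_zero_cancel)
  qed
  have "z \<in> borel_measurable M"
    by (rule borel_measurable_LIMSEQ_metric[OF meas_q lim_q])
  then show ?thesis using z(1) nz by (rule that)
qed

section \<open>Convex combinations of tails\<close>

text \<open>The weights are plain numbers, not functions of a point, so a single choice combines
  whole functions and may be applied to several sequences at once. The lower bound k on the indices
  lets combinations inherit limits.\<close>

definition tail_weights :: "nat \<Rightarrow> nat set \<Rightarrow> (nat \<Rightarrow> real) \<Rightarrow> bool" where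
  "tail_weights k A \<kappa> \<longleftrightarrow> finite A \<and> A \<subseteq> {k..} \<and> (\<forall>j\<in>A. 0 \<le> \<kappa> j) \<and> sum \<kappa> A = 1"

lemma tail_weights_mono: "tail_weights m A \<kappa> \<Longrightarrow> k \<le> m \<Longrightarrow> tail_weights k A \<kappa>"
  by (auto simp: tail_weights_def)

lemma tail_weights_convex:
  assumes "tail_weights k A \<kappa>" "convex C" "\<And>j. j \<ge> k \<Longrightarrow> a j \<in> C"
  shows "(\<Sum>j\<in>A. \<kappa> j *\<^sub>R a j) \<in> C"
  using assms by (intro convex_sum) (auto simp: tail_weights_def)

lemma tail_weights_tendsto:
  fixes a :: "nat \<Rightarrow> 'h::real_normed_vector"
  assumes w: "\<And>k. tail_weights k (A k) (\<kappa> k)" and "a \<longlonglongrightarrow> l"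
  shows "(\<lambda>k. \<Sum>j\<in>A k. \<kappa> k j *\<^sub>R a j) \<longlonglongrightarrow> l"
proof (rule metric_LIMSEQ_I)
  fix \<epsilon> :: real assume "\<epsilon> > 0"
  then obtain N where N: "\<And>j. j \<ge> N \<Longrightarrow> dist (a j) l < \<epsilon>"
    using assms(2) metric_LIMSEQ_D by blast
  have "(\<Sum>j\<in>A k. \<kappa> k j *\<^sub>R a j) \<in> ball l \<epsilon>" if "k \<ge> N" for k
    using w[of k] by (rule tail_weights_convex) (use N that in \<open>auto simp: dist_commute\<close>)
  then show "\<exists>N. \<forall>k\<ge>N. dist (\<Sum>j\<in>A k. \<kappa> k j *\<^sub>R a j) l < \<epsilon>"
    by (auto simp: dist_commute)
qed

text \<open>Both weights are extended by zero to the union of the supports and averaged. The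
  identity holds for every family a, so the midpoint of two combinations of functions is again such
  a combination with constant weights.\<close>

lemma tail_weights_midpoint:
  assumes "tail_weights k A \<kappa>" "tail_weights k B \<mu>"
  obtains D \<nu> where "tail_weights k D \<nu>"
    "\<And>a :: nat \<Rightarrow> 'h::real_vector. (\<Sum>j\<in>D. \<nu> j *\<^sub>R a j) =
        (1/2) *\<^sub>R ((\<Sum>j\<in>A. \<kappa> j *\<^sub>R a j) + (\<Sum>j\<in>B. \<mu> j *\<^sub>R a j))"
proof -
  define \<nu> where "\<nu> j = (1/2) * ((if j \<in> A then \<kappa> j else 0) + (if j \<in> B then \<mu> j else 0))" for j
  have fin: "finite A" "finite B" using assms by (auto simp: tail_weights_def)
  have ext: "(\<Sum>j\<in>A \<union> B. (if j \<in> A then \<kappa> j else 0) *\<^sub>R a j) = (\<Sum>j\<in>A. \<kappa> j *\<^sub>R a j)"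
    "(\<Sum>j\<in>A \<union> B. (if j \<in> B then \<mu> j else 0) *\<^sub>R a j) = (\<Sum>j\<in>B. \<mu> j *\<^sub>R a j)"
    for a :: "nat \<Rightarrow> 'c::real_vector"
    using fin by (auto intro!: sum.mono_neutral_cong_right)
  have comb: "(\<Sum>j\<in>A \<union> B. \<nu> j *\<^sub>R a j) =
      (1/2) *\<^sub>R ((\<Sum>j\<in>A. \<kappa> j *\<^sub>R a j) + (\<Sum>j\<in>B. \<mu> j *\<^sub>R a j))" for a :: "nat \<Rightarrow> 'c::real_vector"
    unfolding ext[symmetric] sum.distrib[symmetric] scaleR_sum_right
    by (simp add: \<nu>_def scaleR_add_left[symmetric])
  \<comment> \<open>For the constant family 1 the identity computes the total mass of the averaged
    weights.\<close>
  have "sum \<nu> (A \<union> B) = 1"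
    using comb[of "\<lambda>_. 1::real"] assms by (simp add: tail_weights_def)
  then have "tail_weights k (A \<union> B) \<nu>"
    using assms by (auto simp: tail_weights_def \<nu>_def)
  then show ?thesis using comb that by blast
qed

text \<open>The factor \<open>4^i\<close> on squares becomes \<open>2^i\<close> on norms, which
  leaves a geometric majorant.\<close>

lemma summable_norm_from_bounded_squares:
  assumes "\<And>i. (4::real)^i * (norm (\<Delta> i))\<^sup>2 \<le> B"
  shows "summable (\<lambda>i. norm (\<Delta> i))"
proof (rule summable_comparison_test)
  show "summable (\<lambda>i. sqrt B * (1/2)^i)" by (intro summable_mult summable_geometric) auto
  show "\<exists>N. \<forall>i\<ge>N. norm (norm (\<Delta> i)) \<le> sqrt B * (1/2)^i"
  proof (intro exI[of _ 0] allI impI)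
    fix i
    have "(2^i * norm (\<Delta> i))\<^sup>2 \<le> B"
      using assms[of i] by (simp add: power_mult_distrib power_mult[symmetric] mult.commute[of i 2] power_mult[of 2 2 i])
    then have "2^i * norm (\<Delta> i) \<le> sqrt B" by (rule real_le_rsqrt)
    then show "norm (norm (\<Delta> i)) \<le> sqrt B * (1/2)^i"
      by (simp add: power_divide field_simps)
  qed
qed

text \<open>
  Convex combinations of almost minimal weighted \<open>L\<^sup>2\<close> norm in the tails form a Cauchy sequence by
  the parallelogram identity; the weight \<open>1/(1+|\<phi>|)\<close> makes \<open>L\<^sup>1\<close>-dominated functions square integrable.
\<close>

lemma dominated_convex_combinations_converge_AE:
  fixes f :: "nat \<Rightarrow> 'b \<Rightarrow> 'h::{real_inner, banach, second_countable_topology}"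
  assumes f[measurable]: "\<And>n. f n \<in> borel_measurable M"
    and \<phi>: "integrable M \<phi>"
    and dom: "\<And>n. AE x in M. norm (f n x) \<le> \<phi> x"
  shows "\<exists>A \<kappa> h. (\<forall>k. tail_weights k (A k) (\<kappa> k)) \<and> h \<in> borel_measurable M \<and>
    (AE x in M. (\<lambda>k. \<Sum>j\<in>A k. \<kappa> k j *\<^sub>R f j x) \<longlonglongrightarrow> h x)"
proof -
  define \<rho> where "\<rho> x = 1 / (1 + \<bar>\<phi> x\<bar>)" for x
  have [measurable]: "\<phi> \<in> borel_measurable M" using \<phi> by auto
  have [measurable]: "\<rho> \<in> borel_measurable M" unfolding \<rho>_def by measurable
  have \<rho>: "\<rho> x > 0" for x by (auto simp: \<rho>_def)
  define q where "q u x = (norm (u x))\<^sup>2 * \<rho> x" for u :: "'b \<Rightarrow> 'h" and x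
  have q_nn: "0 \<le> q u x" for u x using \<rho>[of x] by (simp add: q_def)
  define Q where "Q u = integral\<^sup>L M (q u)" for u
  define comb where "comb A \<kappa> x = (\<Sum>j\<in>A. \<kappa> j *\<^sub>R f j x)" for A \<kappa> x
  have [measurable]: "comb A \<kappa> \<in> borel_measurable M" for A \<kappa>
    unfolding comb_def by measurable
  have AEall: "AE x in M. \<forall>n. norm (f n x) \<le> \<phi> x" using dom by (simp add: AE_all_countable)
  have comb_le: "AE x in M. norm (comb A \<kappa> x) \<le> \<bar>\<phi> x\<bar>" if "tail_weights k A \<kappa>" for k A \<kappa>
    using AEall
  proof eventually_elim
    case (elim x)
    have "comb A \<kappa> x \<in> cball 0 \<bar>\<phi> x\<bar>"
      unfolding comb_def using that by (rule tail_weights_convex) (use elim in \<open>auto intro: order_trans[OF _ abs_ge_self]\<close>)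
    then show ?case by simp
  qed
  \<comment> \<open>The number b is the size relative to \<phi>: 1 for convex combinations, 2 for
    differences of two of them. One factor of \<bar>\<phi> x\<bar> in the square is absorbed by the
    weight.\<close>
  have int: "integrable M (q u)" and Q_le: "Q u \<le> b\<^sup>2 * (\<integral>x. \<bar>\<phi> x\<bar> \<partial>M)"
    if [measurable]: "u \<in> borel_measurable M" and u: "AE x in M. norm (u x) \<le> b * \<bar>\<phi> x\<bar>" for u b
  proof -
    have le: "AE x in M. q u x \<le> b\<^sup>2 * \<bar>\<phi> x\<bar>"
      using u
    proof eventually_elim
      case (elim x)
      have "(norm (u x))\<^sup>2 \<le> (b * \<bar>\<phi> x\<bar>)\<^sup>2" using elim by (intro power_mono) auto
      then have "q u x \<le> (b * \<bar>\<phi> x\<bar>)\<^sup>2 * \<rho> x"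
        unfolding q_def using \<rho>[of x] by (intro mult_right_mono) auto
      also have "\<dots> = b\<^sup>2 * (\<bar>\<phi> x\<bar> * (\<bar>\<phi> x\<bar> * \<rho> x))" by (simp add: power2_eq_square algebra_simps)
      also have "\<dots> \<le> b\<^sup>2 * (\<bar>\<phi> x\<bar> * 1)"
        by (intro mult_left_mono) (auto simp: \<rho>_def)
      finally show ?case by simp
    qed
    have m: "q u \<in> borel_measurable M" unfolding q_def by measurable
    show "integrable M (q u)"
      using \<phi> le by (intro Bochner_Integration.integrable_bound[of M "\<lambda>x. b\<^sup>2 * \<bar>\<phi> x\<bar>", OF _ m]) (auto simp: q_nn)
    then show "Q u \<le> b\<^sup>2 * (\<integral>x. \<bar>\<phi> x\<bar> \<partial>M)"
      unfolding Q_def using \<phi> le integral_mono_AE[of M "q u" "\<lambda>x. b\<^sup>2 * \<bar>\<phi> x\<bar>"] by simp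
  qed
  have Q0: "0 \<le> Q u" for u unfolding Q_def by (intro integral_nonneg_AE) (auto simp: q_nn)
  define S where "S k = {Q (comb A \<kappa>) |A \<kappa>. tail_weights k A \<kappa>}" for k
  have single: "tail_weights k {k} (\<lambda>_. 1)" for k by (auto simp: tail_weights_def)
  have S_ne: "S k \<noteq> {}" for k using single by (auto simp: S_def)
  have S_bdd: "bdd_below (S k)" for k by (rule bdd_belowI[of _ 0]) (auto simp: S_def Q0)
  \<comment> \<open>Fewer combinations are admissible as k grows, so these infima increase. They are
    bounded by the integral of \<bar>\<phi>\<bar>, hence converge, and the gap
    \<open>L - I k\<close> controls the Cauchy estimate.\<close>
  define I where "I k = Inf (S k)" for k
  have "\<exists>A \<kappa>. tail_weights k A \<kappa> \<and> Q (comb A \<kappa>) < I k + 1 / Suc k" for k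
    using cInf_lessD[OF S_ne, of k "I k + 1 / Suc k"] by (auto simp: I_def S_def)
  then obtain A \<kappa> where w: "\<And>k. tail_weights k (A k) (\<kappa> k)"
    and near: "\<And>k. Q (comb (A k) (\<kappa> k)) < I k + 1 / Suc k" by metis
  define h where "h k = comb (A k) (\<kappa> k)" for k
  have [measurable]: "h k \<in> borel_measurable M" for k unfolding h_def by simp
  have h_le: "AE x in M. norm (h k x) \<le> 1 * \<bar>\<phi> x\<bar>" for k unfolding h_def using comb_le[OF w] by simp
  have I_nn: "0 \<le> I k" for k unfolding I_def by (intro cInf_greatest S_ne) (auto simp: S_def Q0)
  have "mono I"
    unfolding I_def by (intro monoI cInf_superset_mono S_ne S_bdd) (auto simp: S_def intro: tail_weights_mono)
  moreover have "I k \<le> (\<integral>x. \<bar>\<phi> x\<bar> \<partial>M)" for k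
  proof -
    have "I k \<le> Q (h k)" unfolding I_def by (intro cInf_lower S_bdd) (use w in \<open>auto simp: S_def h_def\<close>)
    also have "\<dots> \<le> 1\<^sup>2 * (\<integral>x. \<bar>\<phi> x\<bar> \<partial>M)" by (intro Q_le h_le) simp
    finally show ?thesis by simp
  qed
  ultimately have "convergent I"
    using I_nn by (intro Bseq_mono_convergent BseqI'[of _ "\<integral>x. \<bar>\<phi> x\<bar> \<partial>M"]) (auto simp: mono_def)
  then obtain L where L: "I \<longlonglongrightarrow> L" by (auto simp: convergent_def)
  have I_le: "I k \<le> L" for k using \<open>mono I\<close> L by (intro incseq_le)
  \<comment> \<open>The midpoint of \<open>h k\<close> and \<open>h l\<close> uses only indices from
    k on, so its Q is at least \<open>I k\<close>. Integrating the weighted parallelogram identity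
    turns almost minimality of both into smallness of their difference.\<close>
  have par: "Q (\<lambda>x. h k x - h l x) \<le> 4 * (L - I k) + 4 / Suc k" if kl: "k \<le> l" for k l
  proof -
    obtain D \<nu> where D: "tail_weights k D \<nu>" "\<And>a :: nat \<Rightarrow> 'h. (\<Sum>j\<in>D. \<nu> j *\<^sub>R a j) =
        (1/2) *\<^sub>R ((\<Sum>j\<in>A k. \<kappa> k j *\<^sub>R a j) + (\<Sum>j\<in>A l. \<kappa> l j *\<^sub>R a j))"
      using tail_weights_midpoint[OF w tail_weights_mono[OF w kl]] by blast
    have mid: "comb D \<nu> = (\<lambda>x. (1/2) *\<^sub>R (h k x + h l x))"
      by (auto simp: comb_def h_def D(2))
    have pt: "q (\<lambda>x. h k x - h l x) x = 2 * q (h k) x + 2 * q (h l) x - 4 * q (comb D \<nu>) x" for x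
      unfolding q_def mid
      by (simp add: power_mult_distrib power2_norm_eq_inner inner_diff_left inner_diff_right inner_add_left inner_add_right inner_commute[of "h l x" "h k x"] field_simps)
    have "Q (\<lambda>x. h k x - h l x) = 2 * Q (h k) + 2 * Q (h l) - 4 * Q (comb D \<nu>)"
      unfolding Q_def pt using int[OF _ h_le, of k] int[OF _ h_le, of l] int[of "comb D \<nu>" 1] comb_le[OF D(1)]
      by (subst Bochner_Integration.integral_diff Bochner_Integration.integral_add; auto)+
    moreover have "I k \<le> Q (comb D \<nu>)" unfolding I_def by (intro cInf_lower S_bdd) (use D in \<open>auto simp: S_def\<close>)
    moreover have "1 / real (Suc l) \<le> 1 / Suc k" using kl by (intro divide_left_mono) auto
    moreover have "4 / real (Suc k) = 4 * (1 / Suc k)" by simp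
    ultimately show ?thesis using near[of k] near[of l] I_le[of l] I_le[of k] unfolding h_def by argo
  qed
  have "(\<lambda>k. 4 * (L - I k) + 4 / Suc k) \<longlonglongrightarrow> 4 * (L - L) + 0"
    using LIMSEQ_Suc[OF lim_const_over_n[of "4::real"]] by (intro tendsto_intros L)
  then have lim0: "(\<lambda>k. 4 * (L - I k) + 4 / Suc k) \<longlonglongrightarrow> 0" by simp
  \<comment> \<open>The rate \<open>(1/8)^i\<close> is fast enough to remain summable, as
    \<open>(1/2)^i\<close>, after multiplication by the factor \<open>4^i\<close> used for the
    pointwise summability.\<close>
  have "\<exists>m. \<forall>k\<ge>m. 4 * (L - I k) + 4 / Suc k < (1/8)^i" for i
    using order_tendstoD(2)[OF lim0, of "(1/8)^i"] by (auto simp: eventually_sequentially)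
  then obtain m' where m': "\<And>i k. k \<ge> m' i \<Longrightarrow> 4 * (L - I k) + 4 / Suc k < (1/8)^i" by metis
  \<comment> \<open>The partial sums make m increasing and at least \<open>m'\<close>; the summand i
    ensures \<open>m i \<ge> i\<close>, so the subsequence still consists of tail combinations of
    the required level.\<close>
  define m where "m i = i + (\<Sum>j\<le>i. m' j)" for i
  have m_ge: "m i \<ge> m' i" "m i \<ge> i" for i
    using member_le_sum[of i "{..i}" m'] by (auto simp: m_def)
  have m_mono: "m i \<le> m (Suc i)" for i by (simp add: m_def)
  define \<Delta> where "\<Delta> i x = h (m i) x - h (m (Suc i)) x" for i x
  have [measurable]: "\<Delta> i \<in> borel_measurable M" for i unfolding \<Delta>_def by measurable
  have Q\<Delta>: "Q (\<Delta> i) \<le> (1/8)^i" for i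
    using par[OF m_mono, of i] m'[OF m_ge(1), of i] unfolding \<Delta>_def by simp
  have int\<Delta>: "integrable M (q (\<Delta> i))" for i
  proof (rule int)
    show "AE x in M. norm (\<Delta> i x) \<le> 2 * \<bar>\<phi> x\<bar>"
      using h_le[of "m i"] h_le[of "m (Suc i)"] unfolding \<Delta>_def
      by eventually_elim (auto intro: order_trans[OF norm_triangle_ineq4])
  qed simp
  have [measurable]: "q (\<Delta> i) \<in> borel_measurable M" for i unfolding q_def by measurable
  \<comment> \<open>The series has finite integral, so at almost every x its terms are bounded.
    Since \<open>\<rho> x\<close> is positive this bounds the squares of the increments times
    \<open>4^i\<close>, and the increments are absolutely summable.\<close>
  have "(\<integral>\<^sup>+x. (\<Sum>i. ennreal (4^i * q (\<Delta> i) x)) \<partial>M) = (\<Sum>i. \<integral>\<^sup>+x. ennreal (4^i * q (\<Delta> i) x) \<partial>M)"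
    by (intro nn_integral_suminf) simp
  also have "\<dots> = (\<Sum>i. ennreal (4^i * Q (\<Delta> i)))"
    unfolding Q_def using int\<Delta> by (subst nn_integral_eq_integral) (auto simp: q_nn)
  also have "\<dots> \<le> (\<Sum>i. ennreal ((1/2)^i))"
  proof (intro suminf_le ennreal_leI)
    fix i
    have "4^i * Q (\<Delta> i) \<le> 4^i * (1/8)^i" by (intro mult_left_mono Q\<Delta>) auto
    also have "\<dots> = (1/2)^i" by (simp add: power_mult_distrib[symmetric])
    finally show "4^i * Q (\<Delta> i) \<le> (1/2)^i" .
  qed auto
  also have "\<dots> = ennreal (\<Sum>i. (1/2)^i)"
    by (intro suminf_ennreal2 summable_geometric) auto
  finally have fin: "(\<integral>\<^sup>+x. (\<Sum>i. ennreal (4^i * q (\<Delta> i) x)) \<partial>M) \<noteq> \<infinity>"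
    by (auto simp: top_unique)
  have "AE x in M. (\<Sum>i. ennreal (4^i * q (\<Delta> i) x)) \<noteq> \<infinity>"
    by (rule nn_integral_noteq_infinite) (use fin in auto)
  then have conv: "AE x in M. convergent (\<lambda>i. h (m i) x)"
  proof eventually_elim
    case (elim x)
    have "summable (\<lambda>i. 4^i * q (\<Delta> i) x)"
      using elim by (intro summable_suminf_not_top) (auto simp: q_nn)
    then have "(\<lambda>i. 4^i * q (\<Delta> i) x) \<longlonglongrightarrow> 0" by (rule summable_LIMSEQ_zero)
    then have "Bseq (\<lambda>i. 4^i * q (\<Delta> i) x)" by (rule convergent_imp_Bseq[OF convergentI])
    then obtain B where B: "\<And>i. norm (4^i * q (\<Delta> i) x) \<le> B" unfolding Bseq_def by blast
    have "summable (\<lambda>i. norm (\<Delta> i x))"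
    proof (rule summable_norm_from_bounded_squares)
      fix i
      show "4^i * (norm (\<Delta> i x))\<^sup>2 \<le> B / \<rho> x"
        using B[of i] \<rho>[of x] by (simp add: q_def pos_le_divide_eq algebra_simps)
    qed
    then have "summable (\<lambda>i. \<Delta> i x)" by (rule summable_norm_cancel)
    then have "convergent (\<lambda>n. \<Sum>i<n. \<Delta> i x)" by (simp add: summable_iff_convergent)
    moreover have "(\<Sum>i<n. \<Delta> i x) = h (m 0) x - h (m n) x" for n
      unfolding \<Delta>_def by (rule sum_lessThan_telescope')
    ultimately have "convergent (\<lambda>n. h (m 0) x - h (m n) x)" by (simp only:)
    from convergent_diff[OF convergent_const[of "h (m 0) x"] this] show ?case by simp
  qed
  show ?thesis
  proof (intro exI conjI allI)
    show "tail_weights k (A (m k)) (\<kappa> (m k))" for k using tail_weights_mono[OF w m_ge(2)] .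
    show "(\<lambda>x. lim (\<lambda>i. h (m i) x)) \<in> borel_measurable M"
      by (intro borel_measurable_lim_metric) simp
    show "AE x in M. (\<lambda>k. \<Sum>j\<in>A (m k). \<kappa> (m k) j *\<^sub>R f j x) \<longlonglongrightarrow> lim (\<lambda>i. h (m i) x)"
      using conv by eventually_elim (simp add: convergent_LIMSEQ_iff h_def comb_def)
  qed
qed

section \<open>Bochner integrals over lines and triangles\<close>

text \<open>Each approximating simple function has a version measurable without completion.
  Countably many null sets are discarded, and \<open>lim\<close> gives a measurable function that is
  defined everywhere.\<close>

lemma completion_borel_representative:
  fixes f :: "'b \<Rightarrow> 'h::{banach, second_countable_topology}"
  assumes "f \<in> borel_measurable (completion M)"
  obtains f' where "f' \<in> borel_measurable M" "AE x in M. f x = f' x"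
proof -
  obtain F where F: "\<And>i. simple_function (completion M) (F i)" "\<And>x. x \<in> space (completion M) \<Longrightarrow> (\<lambda>i. F i x) \<longlonglongrightarrow> f x"
    using borel_measurable_implies_sequence_metric[OF assms, of 0] by blast
  have "\<forall>i. \<exists>F'. simple_function M F' \<and> (AE x in M. F i x = F' x)"
    using completion_ex_simple_function[OF F(1)] by auto
  then obtain F' where F': "\<And>i. simple_function M (F' i)" "\<And>i. AE x in M. F i x = F' i x" by metis
  have "AE x in M. \<forall>i. F i x = F' i x" using F'(2) by (simp add: AE_all_countable)
  then have "AE x in M. f x = lim (\<lambda>i. F' i x)"
    using AE_space
  proof eventually_elim
    case (elim x)
    then have "(\<lambda>i. F' i x) \<longlonglongrightarrow> f x" using F(2)[of x] by simp
    then show ?case by (simp add: limI)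
  qed
  moreover have "(\<lambda>x. lim (\<lambda>i. F' i x)) \<in> borel_measurable M"
    by (intro borel_measurable_lim_metric borel_measurable_simple_function F')
  ultimately show ?thesis using that by blast
qed

text \<open>Preimages of an open set under the two functions differ by a null set, and a complete
  measure measures every such modification.\<close>

lemma (in complete_measure) borel_measurable_cong_AE:
  fixes f g :: "'a \<Rightarrow> 'h::topological_space"
  assumes f: "f \<in> borel_measurable M" and eq: "AE x in M. f x = g x"
  shows "g \<in> borel_measurable M"
proof (rule borel_measurableI)
  fix U :: "'h set" assume "open U"
  then have *: "f -` U \<inter> space M \<in> sets M" using f by (auto intro: measurable_sets)
  have "AE x in M. x \<in> f -` U \<inter> space M \<longleftrightarrow> x \<in> g -` U \<inter> space M"
    using eq by eventually_elim simp
  then show "g -` U \<inter> space M \<in> sets M" by (rule in_sets_AE[OF _ *]) auto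
qed

lemma integrable_completion_iff_representative:
  fixes f f' :: "'b \<Rightarrow> 'h::{banach, second_countable_topology}"
  assumes [measurable]: "f' \<in> borel_measurable M" and eq: "AE x in M. f x = f' x"
  shows "integrable (completion M) f \<longleftrightarrow> integrable M f'"
    and "integral\<^sup>L (completion M) f = integral\<^sup>L M f'"
proof -
  have eq': "AE x in completion M. f' x = f x" using AE_completion[OF eq] by eventually_elim simp
  have m: "f' \<in> borel_measurable (completion M)" by (rule measurable_completion) simp
  have mf: "f \<in> borel_measurable (completion M)" using m eq' by (rule completion.borel_measurable_cong_AE)
  show "integrable (completion M) f \<longleftrightarrow> integrable M f'"
    using integrable_cong_AE[OF m mf eq'] integrable_completion[OF assms(1)] by simp
  show "integral\<^sup>L (completion M) f = integral\<^sup>L M f'"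
    using integral_cong_AE[OF m mf eq'] integral_completion[OF assms(1)] by simp
qed

text \<open>Lebesgue measure on the plane is the completion of a product, not a product of
  completions, so Fubini is applied to a Borel representative. For almost every t the representative
  agrees with f almost everywhere on the slice, which carries both conclusions back.\<close>

lemma Fubini_lebesgue:
  fixes f :: "real \<times> real \<Rightarrow> 'h::{banach, second_countable_topology}"
  assumes f: "integrable lebesgue f"
  shows "AE t in lebesgue. integrable lebesgue (\<lambda>s. f (t, s))"
    and "integrable lebesgue (\<lambda>t. \<integral>s. f (t, s) \<partial>lebesgue)"
proof -
  have "f \<in> borel_measurable lebesgue" using f by simp
  then obtain f' where f'[measurable]: "f' \<in> borel_measurable lborel" and eq: "AE x in lborel. f x = f' x"
    by (rule completion_borel_representative)
  have f'_int: "integrable (lborel \<Otimes>\<^sub>M lborel) (\<lambda>(x,y). f' (x, y))"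
    using integrable_completion_iff_representative(1)[OF f' eq] f by (simp add: lborel_prod)
  have "AE x in lborel \<Otimes>\<^sub>M lborel. f x = f' x" using eq unfolding lborel_prod .
  then have AE2: "AE t in lborel. AE s in lborel. f (t, s) = f' (t, s)"
    by (rule lborel_pair.AE_pair)
  have [measurable]: "f' \<in> borel_measurable (lborel \<Otimes>\<^sub>M lborel)" using f' by (simp add: lborel_prod)
  have slice: "AE t in lborel. (integrable lebesgue (\<lambda>s. f (t, s)) \<longleftrightarrow> integrable lborel (\<lambda>s. f' (t, s)))
      \<and> (\<integral>s. f (t, s) \<partial>lebesgue) = (\<integral>s. f' (t, s) \<partial>lborel)"
    using AE2
  proof eventually_elim
    case (elim t)
    have "(\<lambda>s. f' (t, s)) \<in> borel_measurable lborel" by measurable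
    from integrable_completion_iff_representative[OF this elim] show ?case by simp
  qed
  have "AE t in lborel. integrable lborel (\<lambda>s. f' (t, s))"
    by (rule lborel_pair.AE_integrable_fst[OF f'_int])
  with slice have "AE t in lborel. integrable lebesgue (\<lambda>s. f (t, s))" by eventually_elim simp
  then show "AE t in lebesgue. integrable lebesgue (\<lambda>s. f (t, s))" by (rule AE_completion)
  have i: "integrable lborel (\<lambda>t. \<integral>s. f' (t, s) \<partial>lborel)"
    by (rule lborel_pair.integrable_fst[OF f'_int])
  show "integrable lebesgue (\<lambda>t. \<integral>s. f (t, s) \<partial>lebesgue)"
  proof (subst integrable_completion_iff_representative(1))
    show "AE t in lborel. (\<integral>s. f (t, s) \<partial>lebesgue) = (\<integral>s. f' (t, s) \<partial>lborel)"
      using slice by eventually_elim simp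
  qed (use i in auto)
qed

section \<open>Integrals over subintervals and their differentiation\<close>

lemma lebesgue_on_interval_iff:
  fixes f :: "real \<Rightarrow> 'h::{banach, second_countable_topology}"
  shows "integrable (lebesgue_on {u..v}) f \<longleftrightarrow> integrable lebesgue (\<lambda>x. indicator {u..v} x *\<^sub>R f x)"
    and "integral\<^sup>L (lebesgue_on {u..v}) f = (\<integral>x. indicator {u..v} x *\<^sub>R f x \<partial>lebesgue)"
  by (simp_all add: integrable_restrict_space integral_restrict_space)

lemma integrable_lebesgue_on_subinterval:
  fixes f :: "real \<Rightarrow> 'h::{banach, second_countable_topology}"
  assumes "integrable (lebesgue_on {a..b}) f" "a \<le> u" "v \<le> b"
  shows "integrable (lebesgue_on {u..v}) f"
proof -
  have "integrable lebesgue (\<lambda>x. indicator {u..v} x *\<^sub>R (indicator {a..b} x *\<^sub>R f x))"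
    using assms(1) unfolding lebesgue_on_interval_iff by (rule integrable_mult_indicator[rotated]) simp
  also have "(\<lambda>x. indicator {u..v} x *\<^sub>R (indicator {a..b} x *\<^sub>R f x)) = (\<lambda>x. indicator {u..v} x *\<^sub>R f x)"
    using assms by (auto simp: indicator_def)
  finally show ?thesis by (simp add: lebesgue_on_interval_iff)
qed

lemma integral_lebesgue_on_split:
  fixes f :: "real \<Rightarrow> 'h::{banach, second_countable_topology}"
  assumes f: "integrable (lebesgue_on {a..b}) f" and "a \<le> c" "c \<le> b"
  shows "integral\<^sup>L (lebesgue_on {a..b}) f = integral\<^sup>L (lebesgue_on {a..c}) f + integral\<^sup>L (lebesgue_on {c..b}) f"
proof -
  have i: "integrable lebesgue (\<lambda>x. indicator {a..c} x *\<^sub>R f x)" "integrable lebesgue (\<lambda>x. indicator {c..b} x *\<^sub>R f x)"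
    "integrable lebesgue (\<lambda>x. indicator {a..b} x *\<^sub>R f x)"
    using integrable_lebesgue_on_subinterval[OF f] f assms(2,3) by (simp_all add: lebesgue_on_interval_iff)
  \<comment> \<open>The closed pieces share the point c, so their indicators add up only off this
    null set.\<close>
  have "AE x in lebesgue. x \<noteq> c" by (intro AE_completion AE_lborel_singleton)
  then have "AE x in lebesgue. indicator {a..b} x *\<^sub>R f x = indicator {a..c} x *\<^sub>R f x + indicator {c..b} x *\<^sub>R f x"
    by eventually_elim (use assms in \<open>auto simp: indicator_def\<close>)
  then have "(\<integral>x. indicator {a..b} x *\<^sub>R f x \<partial>lebesgue) = (\<integral>x. indicator {a..c} x *\<^sub>R f x + indicator {c..b} x *\<^sub>R f x \<partial>lebesgue)"
    using i by (intro integral_cong_AE) auto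
  then show ?thesis using i by (simp add: lebesgue_on_interval_iff)
qed

lemma AE_lebesgue_on_subinterval:
  assumes "AE x in lebesgue_on {a..b::real}. P x" "a \<le> u" "v \<le> b"
  shows "AE x in lebesgue_on {u..v}. P x"
proof -
  have "AE x in lebesgue. x \<in> {a..b} \<longrightarrow> P x"
    using assms(1) by (simp add: AE_restrict_space_iff)
  then have "AE x in lebesgue. x \<in> {u..v} \<longrightarrow> P x"
    by eventually_elim (use assms in auto)
  then show ?thesis by (simp add: AE_restrict_space_iff)
qed

text \<open>
  Intervals violating the difference quotient bound give, by Vitali's lemma, a disjoint family covering
  a fixed fraction of the exceptional set, and Henstock's lemma makes its total length small.
\<close>

lemma negligible_bad_difference_quotients:
  fixes \<phi> :: "real \<Rightarrow> real"
  assumes \<phi>: "\<phi> integrable_on {a..b}" and \<eta>: "\<eta> > 0"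
  shows "negligible {t \<in> {a..b}. \<forall>\<delta>>0. \<exists>u v. a \<le> u \<and> u \<le> t \<and> t \<le> v \<and> v \<le> b \<and> u < v \<and> v - u < \<delta> \<and>
      \<bar>integral {u..v} \<phi> - (v - u) * \<phi> t\<bar> > \<eta> * (v - u)}" (is "negligible ?E")
  unfolding negligible_outer_le
proof (intro allI impI)
  fix e :: real assume "e > 0"
  \<comment> \<open>Vitali's lemma enlarges radii five times and a bad interval errs by more than
    \<eta> times its length. With this \<epsilon> the chosen intervals have total length below
    \<open>e / 5\<close>, and their enlargements at most e.\<close>
  define \<epsilon> where "\<epsilon> = \<eta> * e / 5"
  have "\<epsilon> > 0" using \<eta> \<open>e > 0\<close> by (simp add: \<epsilon>_def)
  then obtain \<gamma> where \<gamma>: "gauge \<gamma>"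
    and hen: "\<And>p. \<lbrakk>p tagged_partial_division_of (cbox a b); \<gamma> fine p\<rbrakk> \<Longrightarrow>
             (\<Sum>(x,k)\<in>p. norm (measure lborel k *\<^sub>R \<phi> x - integral k \<phi>)) < \<epsilon>"
    using Henstock_lemma[of \<phi> a b \<epsilon>] \<phi> by auto
  \<comment> \<open>The length bound 1 gives the uniform radius bound that Vitali's lemma asks for;
    containment in \<open>\<gamma> t\<close> makes every family of such tagged intervals
    fine.\<close>
  define R where "R t u v \<longleftrightarrow> a \<le> u \<and> u \<le> t \<and> t \<le> v \<and> v \<le> b \<and> u < v \<and> v - u < 1 \<and> {u..v} \<subseteq> \<gamma> t \<and>
      \<bar>integral {u..v} \<phi> - (v - u) * \<phi> t\<bar> > \<eta> * (v - u)" for t u v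
  define EE where "EE = ?E"
  have "\<exists>u v. R t u v" if t: "t \<in> EE" for t
  proof -
    have "open (\<gamma> t)" "t \<in> \<gamma> t" using \<gamma> by (auto simp: gauge_def)
    then obtain \<delta> where \<delta>: "\<delta> > 0" "ball t \<delta> \<subseteq> \<gamma> t" by (auto simp: open_contains_ball)
    obtain u v where uv: "a \<le> u" "u \<le> t" "t \<le> v" "v \<le> b" "u < v" "v - u < min \<delta> 1"
        "\<bar>integral {u..v} \<phi> - (v - u) * \<phi> t\<bar> > \<eta> * (v - u)"
      using t \<delta>(1) unfolding EE_def by (auto dest!: spec[of _ "min \<delta> 1"])
    have "{u..v} \<subseteq> ball t \<delta>" using uv by (auto simp: dist_real_def)
    then show ?thesis
      unfolding R_def using uv \<delta>(2) by (intro exI[of _ u] exI[of _ v]) auto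
  qed
  then obtain u v where "\<And>t. t \<in> EE \<Longrightarrow> R t (u t) (v t)" by metis
  note uv = this[unfolded R_def EE_def]
  define m r where "m t = (u t + v t) / 2" and "r t = (v t - u t) / 2" for t
  have cb: "cball (m t) (r t) = {u t..v t}" for t
    by (simp add: cball_eq_atLeastAtMost m_def r_def field_simps)
  obtain C where C: "countable C" "C \<subseteq> ?E"
     "pairwise (\<lambda>i j. disjnt (cball (m i) (r i)) (cball (m j) (r j))) C"
     "?E \<subseteq> (\<Union>i\<in>C. cball (m i) (5 * r i))"
  proof (rule Vitali_covering_lemma_cballs[where S="?E" and K="?E" and a=m and r=r and B=1])
    show "?E \<subseteq> (\<Union>i\<in>?E. cball (m i) (r i))"
    proof
      fix t assume "t \<in> ?E"
      then show "t \<in> (\<Union>i\<in>?E. cball (m i) (r i))"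
        unfolding cb using uv[of t] by (intro UN_I[of t]) auto
    qed
    show "0 < r i \<and> r i \<le> 1" if "i \<in> ?E" for i using uv[OF that] by (auto simp: r_def)
  qed
  have bound: "measure lebesgue (\<Union>i\<in>D. cball (m i) (5 * r i)) \<le> e" if D: "D \<subseteq> C" "finite D" for D
  proof -
    let ?p = "(\<lambda>t. (t, {u t..v t})) ` D"
    have DE: "t \<in> ?E" if "t \<in> D" for t using D C(2) that by blast
    have p: "?p tagged_partial_division_of cbox a b"
      unfolding tagged_partial_division_of_def
    proof (intro conjI allI impI)
      show "finite ?p" using D by simp
      fix x K assume "(x, K) \<in> ?p"
      then have x: "x \<in> D" "K = {u x..v x}" by auto
      show "x \<in> K" "K \<subseteq> cbox a b" "\<exists>a b. K = cbox a b" using uv[OF DE[OF x(1)]] x by (auto intro!: exI[of _ "u x"] exI[of _ "v x"])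
    next
      fix x K y L assume "(x, K) \<in> ?p \<and> (y, L) \<in> ?p \<and> (x, K) \<noteq> (y, L)"
      then have x: "x \<in> D" "K = {u x..v x}" and y: "y \<in> D" "L = {u y..v y}" "x \<noteq> y" by auto
      have "disjnt (cball (m x) (r x)) (cball (m y) (r y))"
        using C(3) x(1) y(1,3) D(1) by (auto simp: pairwise_def)
      then have "K \<inter> L = {}" using x y by (simp add: cb disjnt_def)
      then show "interior K \<inter> interior L = {}" using interior_subset by blast
    qed
    have fine: "\<gamma> fine ?p" using uv DE by (fastforce simp: fine_def)
    have inj: "inj_on (\<lambda>t. (t, {u t..v t})) D" by (auto simp: inj_on_def)
    have "(\<Sum>t\<in>D. \<eta> * (v t - u t)) \<le> (\<Sum>t\<in>D. norm (measure lborel {u t..v t} *\<^sub>R \<phi> t - integral {u t..v t} \<phi>))"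
    proof (rule sum_mono)
      fix t assume "t \<in> D"
      from uv[OF DE[OF this]] show "\<eta> * (v t - u t) \<le> norm (measure lborel {u t..v t} *\<^sub>R \<phi> t - integral {u t..v t} \<phi>)"
        by (simp add: abs_minus_commute)
    qed
    also have "\<dots> = (\<Sum>(x,k)\<in>?p. norm (measure lborel k *\<^sub>R \<phi> x - integral k \<phi>))"
      by (subst sum.reindex[OF inj]) simp
    also have "\<dots> < \<epsilon>" by (rule hen[OF p fine])
    finally have s: "(\<Sum>t\<in>D. v t - u t) < e / 5"
      unfolding sum_distrib_left[symmetric] \<epsilon>_def using \<eta> by simp
    have "measure lebesgue (\<Union>i\<in>D. cball (m i) (5 * r i)) \<le> (\<Sum>i\<in>D. measure lebesgue (cball (m i) (5 * r i)))"
      using D(2) by (intro measure_UNION_le) auto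
    also have "\<dots> = (\<Sum>i\<in>D. 5 * (v i - u i))"
    proof (rule sum.cong[OF refl])
      fix i assume "i \<in> D"
      then have "u i < v i" using uv[OF DE] by auto
      then show "measure lebesgue (cball (m i) (5 * r i)) = 5 * (v i - u i)"
        by (simp add: cball_eq_atLeastAtMost r_def field_simps)
    qed
    also have "\<dots> \<le> e" using s unfolding sum_distrib_left[symmetric] by simp
    finally show ?thesis .
  qed
  show "\<exists>T. ?E \<subseteq> T \<and> T \<in> lmeasurable \<and> measure lebesgue T \<le> e"
  proof (intro exI conjI)
    show "?E \<subseteq> (\<Union>i\<in>C. cball (m i) (5 * r i))" by (rule C(4))
    show "(\<Union>i\<in>C. cball (m i) (5 * r i)) \<in> lmeasurable"
      by (rule fmeasurable_UN_bound[OF C(1) _ bound]) auto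
    show "measure lebesgue (\<Union>i\<in>C. cball (m i) (5 * r i)) \<le> e"
      by (rule measure_UN_bound[OF C(1) _ bound]) auto
  qed
qed

text \<open>The thresholds \<open>1 / Suc k\<close> suffice, so only countably many null sets are
  removed. Intervals merely contain t, possibly as an endpoint, which is what a derivative within
  the closed interval requires.\<close>

lemma AE_difference_quotients:
  fixes \<phi> :: "real \<Rightarrow> real"
  assumes \<phi>: "integrable (lebesgue_on {a..b}) \<phi>"
  shows "AE t in lebesgue_on {a..b}. \<forall>\<eta>>0. \<exists>\<delta>>0. \<forall>u v. a \<le> u \<and> u \<le> t \<and> t \<le> v \<and> v \<le> b \<and> u < v \<and> v - u < \<delta> \<longrightarrow>
      \<bar>integral\<^sup>L (lebesgue_on {u..v}) \<phi> - (v - u) * \<phi> t\<bar> \<le> \<eta> * (v - u)"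
proof -
  define E where "E \<eta> = {t \<in> {a..b}. \<forall>\<delta>>0. \<exists>u v. a \<le> u \<and> u \<le> t \<and> t \<le> v \<and> v \<le> b \<and> u < v \<and> v - u < \<delta> \<and>
      \<bar>integral {u..v} \<phi> - (v - u) * \<phi> t\<bar> > \<eta> * (v - u)}" for \<eta>
  have "\<phi> integrable_on {a..b}" using \<phi> by (rule integrable_on_lebesgue_on) simp
  then have "negligible (E (1 / Suc k))" for k
    unfolding E_def by (rule negligible_bad_difference_quotients) simp
  then have "AE t in lebesgue. t \<notin> E (1 / Suc k)" for k
    by (simp add: negligible_iff_null_sets AE_not_in)
  then have good: "AE t in lebesgue. \<forall>k. t \<notin> E (1 / Suc k)" by (simp add: AE_all_countable)
  have eq: "integral\<^sup>L (lebesgue_on {u..v}) \<phi> = integral {u..v} \<phi>" if "a \<le> u" "v \<le> b" for u v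
    using integrable_lebesgue_on_subinterval[OF \<phi> that] by (rule lebesgue_integral_eq_integral) simp
  from good have "AE t in lebesgue. t \<in> {a..b} \<longrightarrow> (\<forall>\<eta>>0. \<exists>\<delta>>0. \<forall>u v. a \<le> u \<and> u \<le> t \<and> t \<le> v \<and> v \<le> b \<and> u < v \<and> v - u < \<delta> \<longrightarrow>
      \<bar>integral\<^sup>L (lebesgue_on {u..v}) \<phi> - (v - u) * \<phi> t\<bar> \<le> \<eta> * (v - u))"
  proof eventually_elim
    case (elim t)
    show ?case
    proof (intro impI allI)
      fix \<eta> :: real assume t: "t \<in> {a..b}" and "\<eta> > 0"
      then obtain k where k: "1 / real (Suc k) < \<eta>" by (metis nat_approx_posE)
      have "t \<notin> E (1 / Suc k)" using elim by blast
      then obtain \<delta> where "\<delta> > 0" and \<delta>: "\<forall>u v. a \<le> u \<and> u \<le> t \<and> t \<le> v \<and> v \<le> b \<and> u < v \<and> v - u < \<delta> \<longrightarrow>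
          \<bar>integral {u..v} \<phi> - (v - u) * \<phi> t\<bar> \<le> 1 / Suc k * (v - u)"
        unfolding E_def using t by force
      show "\<exists>\<delta>>0. \<forall>u v. a \<le> u \<and> u \<le> t \<and> t \<le> v \<and> v \<le> b \<and> u < v \<and> v - u < \<delta> \<longrightarrow>
          \<bar>integral\<^sup>L (lebesgue_on {u..v}) \<phi> - (v - u) * \<phi> t\<bar> \<le> \<eta> * (v - u)"
      proof (intro exI[of _ \<delta>] conjI allI impI)
        fix u v assume uv: "a \<le> u \<and> u \<le> t \<and> t \<le> v \<and> v \<le> b \<and> u < v \<and> v - u < \<delta>"
        then have "\<bar>integral {u..v} \<phi> - (v - u) * \<phi> t\<bar> \<le> 1 / Suc k * (v - u)" using \<delta> by blast
        also have "\<dots> \<le> \<eta> * (v - u)" using k uv by (intro mult_right_mono) auto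
        finally show "\<bar>integral\<^sup>L (lebesgue_on {u..v}) \<phi> - (v - u) * \<phi> t\<bar> \<le> \<eta> * (v - u)"
          using eq uv by simp
      qed fact
    qed
  qed
  then show ?thesis by (simp add: AE_restrict_space_iff)
qed

text \<open>Vector-valued Lebesgue points are reduced to scalars: the real result is applied to
  \<open>norm (f s - q)\<close> for all q in a countable dense set, and at a good t some q close to
  \<open>f t\<close> is used.\<close>

lemma indefinite_integral_has_vector_derivative_AE:
  fixes f :: "real \<Rightarrow> 'h::{banach, second_countable_topology}"
  assumes f: "integrable (lebesgue_on {a..b}) f"
  shows "AE t in lebesgue_on {a..b}.
    ((\<lambda>u. integral\<^sup>L (lebesgue_on {a..u}) f) has_vector_derivative f t) (at t within {a..b})"
proof -
  obtain D :: "'h set" where D: "countable D" "\<And>X. open X \<Longrightarrow> X \<noteq> {} \<Longrightarrow> \<exists>d\<in>D. d \<in> X"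
    using countable_dense_exists by auto
  have fsub: "integrable (lebesgue_on {u..v}) f" if "a \<le> u" "v \<le> b" for u v
    using integrable_lebesgue_on_subinterval[OF f that] .
  have const: "integrable (lebesgue_on {u..v}) (\<lambda>_. q)" "integral\<^sup>L (lebesgue_on {u..v}) (\<lambda>_. q) = (v - u) *\<^sub>R q"
    if "u \<le> v" for q :: 'h and u v :: real
  proof -
    have "finite_measure (lebesgue_on {u..v})" by (rule finite_measure_lebesgue_on) simp
    then show "integrable (lebesgue_on {u..v}) (\<lambda>_. q)" by (rule finite_measure.integrable_const)
    show "integral\<^sup>L (lebesgue_on {u..v}) (\<lambda>_. q) = (v - u) *\<^sub>R q"
      using that by (simp add: measure_restrict_space)
  qed
  have diff: "integrable (lebesgue_on {u..v}) (\<lambda>s. f s - q)" if "a \<le> u" "u \<le> v" "v \<le> b" for u v q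
    using fsub const that by (intro Bochner_Integration.integrable_diff) auto
  have "AE t in lebesgue_on {a..b}. \<forall>q\<in>D. \<forall>\<eta>>0. \<exists>\<delta>>0. \<forall>u v. a \<le> u \<and> u \<le> t \<and> t \<le> v \<and> v \<le> b \<and> u < v \<and> v - u < \<delta> \<longrightarrow>
      \<bar>integral\<^sup>L (lebesgue_on {u..v}) (\<lambda>s. norm (f s - q)) - (v - u) * norm (f t - q)\<bar> \<le> \<eta> * (v - u)"
    unfolding AE_ball_countable[OF D(1)]
  proof
    fix q assume "q \<in> D"
    have "integrable (lebesgue_on {a..b}) (\<lambda>s. norm (f s - q))"
    proof (cases "a \<le> b")
      case True
      then show ?thesis using diff[of a b q] by simp
    next
      case False
      then show ?thesis by (simp add: lebesgue_on_interval_iff)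
    qed
    then show "AE t in lebesgue_on {a..b}. \<forall>\<eta>>0. \<exists>\<delta>>0. \<forall>u v. a \<le> u \<and> u \<le> t \<and> t \<le> v \<and> v \<le> b \<and> u < v \<and> v - u < \<delta> \<longrightarrow>
      \<bar>integral\<^sup>L (lebesgue_on {u..v}) (\<lambda>s. norm (f s - q)) - (v - u) * norm (f t - q)\<bar> \<le> \<eta> * (v - u)"
      by (rule AE_difference_quotients)
  qed
  moreover have "AE t in lebesgue_on {a..b}. t \<in> {a..b}"
    by (intro AE_I2) simp
  ultimately show ?thesis
  proof eventually_elim
    case (elim t)
    then have t: "a \<le> t" "t \<le> b" by auto
    define U where "U u = integral\<^sup>L (lebesgue_on {a..u}) f" for u
    have key: "\<exists>\<delta>>0. \<forall>u v. a \<le> u \<and> u \<le> t \<and> t \<le> v \<and> v \<le> b \<and> u < v \<and> v - u < \<delta> \<longrightarrow>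
       norm (U v - U u - (v - u) *\<^sub>R f t) \<le> \<epsilon> * (v - u)" if \<epsilon>: "\<epsilon> > 0" for \<epsilon>
    proof -
      have "open (ball (f t) (\<epsilon>/3))" "ball (f t) (\<epsilon>/3) \<noteq> {}" using \<epsilon> by auto
      \<comment> \<open>The mean of \<open>norm (f s - q)\<close> is at most its value at t plus
        \<open>\<epsilon>/3\<close>, and replacing q by \<open>f t\<close> costs that value once
        more. Three thirds make \<epsilon>.\<close>
      then obtain q where q: "q \<in> D" "dist (f t) q < \<epsilon>/3" using D(2) by (metis mem_ball)
      obtain \<delta> where "\<delta> > 0" and \<delta>: "\<And>u v. a \<le> u \<and> u \<le> t \<and> t \<le> v \<and> v \<le> b \<and> u < v \<and> v - u < \<delta> \<Longrightarrow>
        \<bar>integral\<^sup>L (lebesgue_on {u..v}) (\<lambda>s. norm (f s - q)) - (v - u) * norm (f t - q)\<bar> \<le> \<epsilon>/3 * (v - u)"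
        using bspec[OF elim(1) q(1), THEN spec, of "\<epsilon>/3"] \<epsilon> by auto
      have "norm (U v - U u - (v - u) *\<^sub>R f t) \<le> \<epsilon> * (v - u)"
        if uv: "a \<le> u \<and> u \<le> t \<and> t \<le> v \<and> v \<le> b \<and> u < v \<and> v - u < \<delta>" for u v
      proof -
        have "U v = U u + integral\<^sup>L (lebesgue_on {u..v}) f"
          unfolding U_def using uv by (intro integral_lebesgue_on_split fsub) auto
        moreover have "integral\<^sup>L (lebesgue_on {u..v}) (\<lambda>s. f s - q) = integral\<^sup>L (lebesgue_on {u..v}) f - (v - u) *\<^sub>R q"
          using uv fsub const by (subst Bochner_Integration.integral_diff) auto
        ultimately have "U v - U u - (v - u) *\<^sub>R f t
            = integral\<^sup>L (lebesgue_on {u..v}) (\<lambda>s. f s - q) + (v - u) *\<^sub>R (q - f t)"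
          by (simp add: algebra_simps)
        also have "norm \<dots> \<le> integral\<^sup>L (lebesgue_on {u..v}) (\<lambda>s. norm (f s - q)) + (v - u) * norm (f t - q)"
          using uv by (intro order_trans[OF norm_triangle_ineq] add_mono integral_norm_bound) (simp add: norm_minus_commute)
        also have "\<dots> \<le> (v - u) * norm (f t - q) + \<epsilon>/3 * (v - u) + (v - u) * norm (f t - q)"
          using \<delta>[OF uv] unfolding abs_le_iff by linarith
        also have "\<dots> = (v - u) * (2 * norm (f t - q) + \<epsilon>/3)" by (simp add: algebra_simps)
        also have "\<dots> \<le> (v - u) * \<epsilon>"
          using q(2) uv by (intro mult_left_mono) (auto simp: dist_norm)
        finally show ?thesis by (simp add: mult.commute)
      qed
      then show ?thesis using \<open>\<delta> > 0\<close> by blast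
    qed
    show ?case
      unfolding has_vector_derivative_def has_derivative_within_alt
    proof (intro conjI allI impI)
      show "bounded_linear (\<lambda>x. x *\<^sub>R f t)" by (rule bounded_linear_scaleR_left)
      fix \<epsilon> :: real assume "\<epsilon> > 0"
      from key[OF this] obtain \<delta> where "\<delta> > 0" and \<delta>: "\<And>u v. a \<le> u \<and> u \<le> t \<and> t \<le> v \<and> v \<le> b \<and> u < v \<and> v - u < \<delta> \<Longrightarrow>
       norm (U v - U u - (v - u) *\<^sub>R f t) \<le> \<epsilon> * (v - u)" by blast
      have "norm (U y - U t - (y - t) *\<^sub>R f t) \<le> \<epsilon> * norm (y - t)" if y: "y \<in> {a..b}" "norm (y - t) < \<delta>" for y
      proof -
        consider "y = t" | "t < y" | "y < t" by linarith
        then show ?thesis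
        proof cases
          case 2
          then show ?thesis using \<delta>[of t y] y t by simp
        next
          case 3
          have "U y - U t - (y - t) *\<^sub>R f t = - (U t - U y - (t - y) *\<^sub>R f t)" by (simp add: algebra_simps)
          then show ?thesis using \<delta>[of y t] y t 3 by (simp only: norm_minus_cancel) simp
        qed simp
      qed
      then show "\<exists>d>0. \<forall>y\<in>{a..b}. norm (y - t) < d \<longrightarrow>
         norm (integral\<^sup>L (lebesgue_on {a..y}) f - integral\<^sup>L (lebesgue_on {a..t}) f - (y - t) *\<^sub>R f t) \<le> \<epsilon> * norm (y - t)"
        using \<open>\<delta> > 0\<close> unfolding U_def by blast
    qed
  qed
qed

section \<open>Integration over the triangle of times with memory\<close>

lemma integral_lebesgue_on_singleton [simp]:
  fixes f :: "real \<Rightarrow> 'h::{banach, second_countable_topology}"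
  shows "integral\<^sup>L (lebesgue_on {a}) f = 0"
proof -
  have "AE x in lebesgue. x \<noteq> a" by (intro AE_completion AE_lborel_singleton)
  then have "AE x in lebesgue. indicator {a..a} x *\<^sub>R f x = 0" by eventually_elim auto
  then have "integral\<^sup>L (lebesgue_on {a..a}) f = 0"
    unfolding lebesgue_on_interval_iff by (rule integral_eq_zero_AE)
  then show ?thesis by simp
qed

text \<open>The integrand is extended by zero to the plane. Its slice at t in \<open>{0..T}\<close>
  then lives on \<open>{0..t}\<close>, and all other slices vanish, so the plane theorem yields
  integrability of the memory integral as a function of t.\<close>

lemma Fubini_triangle:
  fixes h :: "real \<Rightarrow> real \<Rightarrow> 'h::{banach, second_countable_topology}"
  assumes "integrable (lebesgue_on {(t, s). 0 \<le> s \<and> s \<le> t \<and> t \<le> T}) (\<lambda>(t, s). h t s)"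
  shows "AE t in lebesgue_on {0..T}. integrable (lebesgue_on {0..t}) (h t)"
    and "integrable (lebesgue_on {0..T}) (\<lambda>t. integral\<^sup>L (lebesgue_on {0..t}) (h t))"
proof -
  let ?D = "{(t, s). 0 \<le> s \<and> s \<le> t \<and> t \<le> T}"
  have "closed {p :: real \<times> real. 0 \<le> snd p \<and> snd p \<le> fst p \<and> fst p \<le> T}"
    by (intro closed_Collect_conj closed_Collect_le continuous_intros)
  also have "{p :: real \<times> real. 0 \<le> snd p \<and> snd p \<le> fst p \<and> fst p \<le> T} = ?D" by auto
  finally have D: "?D \<in> sets lebesgue" by auto
  have int: "integrable lebesgue (\<lambda>p. indicator ?D p *\<^sub>R (case p of (t, s) \<Rightarrow> h t s))"
    using assms D by (subst (asm) integrable_restrict_space) auto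
  have ind: "indicator ?D (t, s) *\<^sub>R h t s = indicator {0..t} s *\<^sub>R h t s" if "t \<in> {0..T}" for t s
    using that by (auto simp: indicator_def)
  have ind0: "indicator ?D (t, s) = (0::real)" if "t \<notin> {0..T}" for t s
    using that by (auto simp: indicator_def)
  have "AE t in lebesgue. t \<in> {0..T} \<longrightarrow> integrable (lebesgue_on {0..t}) (h t)"
    using Fubini_lebesgue(1)[OF int] by eventually_elim (auto simp: ind lebesgue_on_interval_iff)
  then show "AE t in lebesgue_on {0..T}. integrable (lebesgue_on {0..t}) (h t)"
    by (simp add: AE_restrict_space_iff)
  have "(\<lambda>t. \<integral>s. indicator ?D (t, s) *\<^sub>R (case (t, s) of (t, s) \<Rightarrow> h t s) \<partial>lebesgue)
      = (\<lambda>t. indicator {0..T} t *\<^sub>R integral\<^sup>L (lebesgue_on {0..t}) (h t))"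
  proof
    fix t
    show "(\<integral>s. indicator ?D (t, s) *\<^sub>R (case (t, s) of (t, s) \<Rightarrow> h t s) \<partial>lebesgue)
       = indicator {0..T} t *\<^sub>R integral\<^sup>L (lebesgue_on {0..t}) (h t)"
    proof (cases "t \<in> {0..T}")
      case True
      then show ?thesis by (simp add: lebesgue_on_interval_iff ind)
    next
      case False
      then show ?thesis by (simp add: ind0[OF False] del: atLeastAtMost_iff)
    qed
  qed
  with Fubini_lebesgue(2)[OF int] show "integrable (lebesgue_on {0..T}) (\<lambda>t. integral\<^sup>L (lebesgue_on {0..t}) (h t))"
    by (simp add: lebesgue_on_interval_iff)
qed

lemma continuous_on_indefinite_lebesgue_integral:
  fixes \<phi> :: "real \<Rightarrow> real"
  assumes "integrable (lebesgue_on {a..b}) \<phi>"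
  shows "continuous_on {a..b} (\<lambda>t. integral\<^sup>L (lebesgue_on {a..t}) \<phi>)"
proof -
  have "\<phi> integrable_on {a..b}" using assms by (rule integrable_on_lebesgue_on) simp
  then have "continuous_on {a..b} (\<lambda>t. integral {a..t} \<phi>)" by (rule indefinite_integral_continuous_1)
  moreover have "integral {a..t} \<phi> = integral\<^sup>L (lebesgue_on {a..t}) \<phi>" if "t \<in> {a..b}" for t
    using integrable_lebesgue_on_subinterval[OF assms, of a t] that
    by (subst lebesgue_integral_eq_integral) auto
  ultimately show ?thesis by (rule continuous_on_eq)
qed

lemma integral_lebesgue_on_nonneg:
  fixes \<phi> :: "real \<Rightarrow> real"
  assumes "\<And>x. x \<in> {a..b} \<Longrightarrow> 0 \<le> \<phi> x"
  shows "0 \<le> integral\<^sup>L (lebesgue_on {a..b}) \<phi>"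
  using assms by (intro integral_nonneg_AE AE_I2) auto

section \<open>The growth bound\<close>

text \<open>The bound \<open>r\<close> dominates one explicit Euler step of \<open>\<rho>' = (c + \<Sigma>) \<rho> + d + \<Sigma>\<close>.\<close>

locale growth_bound =
  fixes T :: real and N0 :: real and c d :: "real \<Rightarrow> real" and \<sigma> :: "real \<Rightarrow> real \<Rightarrow> real"
  assumes T_pos: "0 < T" and N0: "0 \<le> N0"
    and c_int: "integrable (lebesgue_on {0..T}) c" and c_nn: "\<And>t. t \<in> {0..T} \<Longrightarrow> 0 \<le> c t"
    and d_int: "integrable (lebesgue_on {0..T}) d" and d_nn: "\<And>t. t \<in> {0..T} \<Longrightarrow> 0 \<le> d t"
    and \<sigma>_int: "integrable (lebesgue_on {(t, s). 0 \<le> s \<and> s \<le> t \<and> t \<le> T}) (\<lambda>(t, s). \<sigma> t s)"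
    and \<sigma>_nn: "\<And>t s. 0 \<le> s \<Longrightarrow> s \<le> t \<Longrightarrow> t \<le> T \<Longrightarrow> 0 \<le> \<sigma> t s"
begin

abbreviation (input) "\<Sigma> \<equiv> inner_sigma \<sigma>"
abbreviation (input) "E \<equiv> e_fun c \<sigma>"
abbreviation (input) "r \<equiv> r_fun N0 c d \<sigma>"

lemma \<sigma>_slice: "AE t in lebesgue_on {0..T}. integrable (lebesgue_on {0..t}) (\<sigma> t)"
  using Fubini_triangle(1)[OF \<sigma>_int] .

lemma \<Sigma>_int: "integrable (lebesgue_on {0..T}) \<Sigma>"
  using Fubini_triangle(2)[OF \<sigma>_int] unfolding inner_sigma_def .

lemma \<Sigma>_nn: "t \<in> {0..T} \<Longrightarrow> 0 \<le> \<Sigma> t"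
  unfolding inner_sigma_def using \<sigma>_nn by (intro integral_lebesgue_on_nonneg) auto

lemma rate_int: "integrable (lebesgue_on {0..T}) (\<lambda>s. c s + \<Sigma> s)"
  using c_int \<Sigma>_int by simp

lemma forcing_int: "integrable (lebesgue_on {0..T}) (\<lambda>s. d s + \<Sigma> s)"
  using d_int \<Sigma>_int by simp

lemma rate_nn: "t \<in> {0..T} \<Longrightarrow> 0 \<le> c t + \<Sigma> t"
  using c_nn \<Sigma>_nn by (simp add: add_nonneg_nonneg)

lemma forcing_nn: "t \<in> {0..T} \<Longrightarrow> 0 \<le> d t + \<Sigma> t"
  using d_nn \<Sigma>_nn by (simp add: add_nonneg_nonneg)

lemma E_mult: "0 \<le> u \<Longrightarrow> u \<le> s \<Longrightarrow> s \<le> t \<Longrightarrow> t \<le> T \<Longrightarrow> E t u = E t s * E s u"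
  unfolding e_fun_def exp_add[symmetric]
  using integral_lebesgue_on_split[OF integrable_lebesgue_on_subinterval[OF rate_int, of u t], of s]
  by (simp add: add.commute)

lemma E_ge: "0 \<le> s \<Longrightarrow> t \<le> T \<Longrightarrow> 1 + integral\<^sup>L (lebesgue_on {s..t}) (\<lambda>u. c u + \<Sigma> u) \<le> E t s"
  unfolding e_fun_def by (rule exp_ge_add_one_self)

lemma E_ge_1: "0 \<le> s \<Longrightarrow> t \<le> T \<Longrightarrow> 1 \<le> E t s"
  using E_ge[of s t] integral_lebesgue_on_nonneg[of s t "\<lambda>u. c u + \<Sigma> u"] rate_nn by fastforce

text \<open>As a function of its second argument, \<open>E t u\<close> is
  \<open>exp (A t - A u)\<close> with A a continuous primitive of the rate; it is therefore
  measurable and bounded on the compact interval and may multiply an integrable function.\<close>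

lemma forcing_E_int:
  assumes "0 \<le> t" "t \<le> T"
  shows "integrable (lebesgue_on {0..t}) (\<lambda>u. (d u + \<Sigma> u) * E t u)"
proof -
  define A where "A u = integral\<^sup>L (lebesgue_on {0..u}) (\<lambda>u. c u + \<Sigma> u)" for u
  have rt: "integrable (lebesgue_on {0..t}) (\<lambda>s. c s + \<Sigma> s)"
    using integrable_lebesgue_on_subinterval[OF rate_int, of 0 t] assms by simp
  have E: "E t u = exp (A t - A u)" if "u \<in> {0..t}" for u
    using integral_lebesgue_on_split[OF rt, of u] that unfolding e_fun_def A_def by simp
  have "continuous_on {0..t} A" unfolding A_def by (rule continuous_on_indefinite_lebesgue_integral[OF rt])
  then have cont: "continuous_on {0..t} (\<lambda>u. exp (A t - A u))" by (intro continuous_intros)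
  then have meas: "(\<lambda>u. exp (A t - A u)) \<in> borel_measurable (lebesgue_on {0..t})"
    by (rule continuous_imp_measurable_on_sets_lebesgue) simp
  have "compact ((\<lambda>u. exp (A t - A u)) ` {0..t})" using cont by (rule compact_continuous_image) simp
  from compact_imp_bounded[OF this] obtain B where "\<forall>x\<in>(\<lambda>u. exp (A t - A u)) ` {0..t}. norm x \<le> B"
    unfolding bounded_iff by (elim exE)
  then have B: "\<And>u. u \<in> {0..t} \<Longrightarrow> \<bar>exp (A t - A u)\<bar> \<le> B" by simp
  have f: "integrable (lebesgue_on {0..t}) (\<lambda>s. d s + \<Sigma> s)"
    using integrable_lebesgue_on_subinterval[OF forcing_int, of 0 t] assms by simp
  have "integrable (lebesgue_on {0..t}) (\<lambda>u. (d u + \<Sigma> u) * exp (A t - A u))"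
  proof (rule Bochner_Integration.integrable_bound)
    show "integrable (lebesgue_on {0..t}) (\<lambda>s. B * (d s + \<Sigma> s))" using f by simp
    show "(\<lambda>u. (d u + \<Sigma> u) * exp (A t - A u)) \<in> borel_measurable (lebesgue_on {0..t})"
      using f by (intro borel_measurable_times meas) auto
    show "AE x in lebesgue_on {0..t}. norm ((d x + \<Sigma> x) * exp (A t - A x)) \<le> norm (B * (d x + \<Sigma> x))"
    proof (intro AE_I2)
      fix x assume "x \<in> space (lebesgue_on {0..t})"
      then have "\<bar>exp (A t - A x)\<bar> \<le> \<bar>B\<bar>" using B[of x] by auto
      then show "norm ((d x + \<Sigma> x) * exp (A t - A x)) \<le> norm (B * (d x + \<Sigma> x))"
        unfolding real_norm_def abs_mult by (subst mult.commute) (rule mult_right_mono; simp)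
    qed
  qed
  moreover have "integrable (lebesgue_on {0..t}) (\<lambda>u. (d u + \<Sigma> u) * exp (A t - A u))
      \<longleftrightarrow> integrable (lebesgue_on {0..t}) (\<lambda>u. (d u + \<Sigma> u) * E t u)"
    by (rule Bochner_Integration.integrable_cong[OF refl]) (simp add: E)
  ultimately show ?thesis by simp
qed

lemma r_nn:
  assumes "0 \<le> t" "t \<le> T" shows "0 \<le> r t"
  unfolding r_fun_def
proof (intro add_nonneg_nonneg mult_nonneg_nonneg integral_lebesgue_on_nonneg N0)
  have E_nn: "0 \<le> E t x" if "0 \<le> x" for x using E_ge_1[of x t] that assms by simp
  show "0 \<le> E t 0" by (rule E_nn) simp
  fix x assume x: "x \<in> {0..t}"
  show "0 \<le> E t x" using E_nn x by simp
  show "0 \<le> d x" "0 \<le> \<Sigma> x" using d_nn[of x] \<Sigma>_nn[of x] x assms by auto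
qed

lemma r_0: "r 0 = N0"
  by (simp add: r_fun_def e_fun_def)

text \<open>Variation of constants restarts r at s: \<open>r t\<close> is \<open>E t s * r s\<close>
  plus the forcing on \<open>{s..t}\<close> weighted by \<open>E t u\<close>. Now \<open>exp\<close>
  dominates its linear part in the first term and 1 in the second, which leaves the explicit Euler
  increment.\<close>

lemma r_step:
  assumes "0 \<le> s" "s \<le> t" "t \<le> T"
  shows "r s + r s * integral\<^sup>L (lebesgue_on {s..t}) (\<lambda>u. c u + \<Sigma> u)
      + integral\<^sup>L (lebesgue_on {s..t}) (\<lambda>u. d u + \<Sigma> u) \<le> r t"
proof -
  have i: "integrable (lebesgue_on {0..t}) (\<lambda>u. (d u + \<Sigma> u) * E t u)"
    using forcing_E_int assms by simp
  have "integral\<^sup>L (lebesgue_on {0..s}) (\<lambda>u. (d u + \<Sigma> u) * E t u)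
      = integral\<^sup>L (lebesgue_on {0..s}) (\<lambda>u. E t s * ((d u + \<Sigma> u) * E s u))"
  proof (rule Bochner_Integration.integral_cong[OF refl])
    fix u assume "u \<in> space (lebesgue_on {0..s})"
    then show "(d u + \<Sigma> u) * E t u = E t s * ((d u + \<Sigma> u) * E s u)"
      using E_mult[of u s t] assms by simp
  qed
  also have "\<dots> = E t s * integral\<^sup>L (lebesgue_on {0..s}) (\<lambda>u. (d u + \<Sigma> u) * E s u)"
    by (rule integral_mult_right_zero)
  finally have "r t = E t s * r s + integral\<^sup>L (lebesgue_on {s..t}) (\<lambda>u. (d u + \<Sigma> u) * E t u)"
    using integral_lebesgue_on_split[OF i, of s] assms E_mult[of 0 s t]
    by (simp add: r_fun_def distrib_left mult.left_commute)
  moreover have "integral\<^sup>L (lebesgue_on {s..t}) (\<lambda>u. d u + \<Sigma> u) \<le> integral\<^sup>L (lebesgue_on {s..t}) (\<lambda>u. (d u + \<Sigma> u) * E t u)"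
  proof (rule integral_mono_AE)
    show "AE x in lebesgue_on {s..t}. d x + \<Sigma> x \<le> (d x + \<Sigma> x) * E t x"
    proof (intro AE_I2)
      fix x assume "x \<in> space (lebesgue_on {s..t})"
      then have x: "x \<in> {0..T}" using assms by auto
      show "d x + \<Sigma> x \<le> (d x + \<Sigma> x) * E t x"
        using mult_left_mono[OF E_ge_1[of x t] forcing_nn[OF x]] x assms by simp
    qed
  qed (use integrable_lebesgue_on_subinterval[OF i, of s t] integrable_lebesgue_on_subinterval[OF forcing_int, of s t] assms in auto)
  moreover have "(1 + integral\<^sup>L (lebesgue_on {s..t}) (\<lambda>u. c u + \<Sigma> u)) * r s \<le> E t s * r s"
    using assms by (intro mult_right_mono E_ge r_nn) auto
  ultimately show ?thesis by (simp add: algebra_simps)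
qed

lemma r_mono:
  assumes "0 \<le> s" "s \<le> t" "t \<le> T" shows "r s \<le> r t"
proof -
  have "0 \<le> integral\<^sup>L (lebesgue_on {s..t}) (\<lambda>u. c u + \<Sigma> u)" "0 \<le> integral\<^sup>L (lebesgue_on {s..t}) (\<lambda>u. d u + \<Sigma> u)"
    using assms rate_nn forcing_nn by (auto intro!: integral_lebesgue_on_nonneg)
  moreover from this(1) have "0 \<le> r s * integral\<^sup>L (lebesgue_on {s..t}) (\<lambda>u. c u + \<Sigma> u)"
    using r_nn[of s] assms by (intro mult_nonneg_nonneg) auto
  ultimately show ?thesis using r_step[OF assms] by linarith
qed

lemma r_measurable:
  assumes "0 \<le> t" "t \<le> T" shows "r \<in> borel_measurable (lebesgue_on {0..t})"
proof -
  \<comment> \<open>Monotonicity of r is known on \<open>{0..T}\<close> only; clamping the argument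
    extends it to a monotone function on the line.\<close>
  have "mono (\<lambda>x. r (max 0 (min T x)))"
    using T_pos by (intro monoI r_mono) auto
  then have "(\<lambda>x. r (max 0 (min T x))) \<in> borel_measurable borel" by (rule borel_measurable_mono)
  then have "(\<lambda>x. r (max 0 (min T x))) \<in> borel_measurable lebesgue"
    by (auto intro: measurable_completion)
  then have "(\<lambda>x. r (max 0 (min T x))) \<in> borel_measurable (lebesgue_on {0..t})"
    by (rule measurable_restrict_space1)
  then show ?thesis
    by (rule measurable_cong[THEN iffD1, rotated -1]) (use assms in auto)
qed

lemma \<sigma>_r_int:
  assumes t: "0 \<le> t" "t \<le> T" and \<sigma>: "integrable (lebesgue_on {0..t}) (\<sigma> t)"
  shows "integrable (lebesgue_on {0..t}) (\<lambda>s. \<sigma> t s * r s)"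
proof (rule Bochner_Integration.integrable_bound)
  show "integrable (lebesgue_on {0..t}) (\<lambda>s. r T * \<sigma> t s)" using \<sigma> by simp
  show "(\<lambda>s. \<sigma> t s * r s) \<in> borel_measurable (lebesgue_on {0..t})"
    using \<sigma> r_measurable[OF t] by (intro borel_measurable_times) auto
  show "AE s in lebesgue_on {0..t}. norm (\<sigma> t s * r s) \<le> norm (r T * \<sigma> t s)"
  proof (intro AE_I2)
    fix s assume "s \<in> space (lebesgue_on {0..t})"
    then have "0 \<le> r s" "r s \<le> r T" "0 \<le> \<sigma> t s" using t by (auto intro!: r_nn r_mono \<sigma>_nn)
    then show "norm (\<sigma> t s * r s) \<le> norm (r T * \<sigma> t s)"
      by (simp add: abs_mult mult.commute[of "r T"] mult_left_mono)
  qed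
qed

end

section \<open>Euler polygons\<close>

text \<open>The hypotheses appear in the form in which they are consumed: measurability as hits of
  balls, weak upper semicontinuity as stability of open half-spaces, local Lipschitz continuity as
  continuity. The class \<open>banach\<close> makes Bochner integration available.\<close>

locale projected_inclusion = growth_bound T "norm x0" c d \<sigma>
  for T :: real and x0 :: "'h::{real_inner, banach, second_countable_topology}"
    and c d :: "real \<Rightarrow> real" and \<sigma> :: "real \<Rightarrow> real \<Rightarrow> real" +
  fixes e :: "nat \<Rightarrow> 'h" and n :: nat and F :: "real \<Rightarrow> 'h \<Rightarrow> 'h set" and g :: "real \<Rightarrow> real \<Rightarrow> 'h \<Rightarrow> 'h"
  assumes ortho: "\<And>i j. i \<in> {1..n} \<Longrightarrow> j \<in> {1..n} \<Longrightarrow> e i \<bullet> e j = (if i = j then 1 else 0)"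
    and F_ne: "\<And>t v. t \<in> {0..T} \<Longrightarrow> F t v \<noteq> {}"
    and F_closed: "\<And>t v. t \<in> {0..T} \<Longrightarrow> closed (F t v)"
    and F_convex: "\<And>t v. t \<in> {0..T} \<Longrightarrow> convex (F t v)"
    and F1: "\<And>v p \<rho>. {t \<in> {0..T}. F t v \<inter> ball p \<rho> \<noteq> {}} \<in> sets (lebesgue_on {0..T})"
    and F2: "AE t in lebesgue_on {0..T}. \<forall>v p \<alpha>. (\<forall>w\<in>F t v. w \<bullet> p < \<alpha>) \<longrightarrow>
        (\<exists>\<delta>>0. \<forall>u. dist u v < \<delta> \<longrightarrow> (\<forall>w\<in>F t u. w \<bullet> p < \<alpha>))"
    and F3: "AE t in lebesgue_on {0..T}. \<forall>v. Inf (norm ` F t v) \<le> c t * norm v + d t"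
    and g1: "\<And>v. (\<lambda>(t, s). g t s v) \<in> borel_measurable (lebesgue_on ({0..T} \<times> {0..T}))"
    and g2: "\<And>t s. 0 \<le> s \<Longrightarrow> s \<le> t \<Longrightarrow> t \<le> T \<Longrightarrow> continuous_on UNIV (g t s)"
    and g3: "\<And>t s x. 0 \<le> s \<Longrightarrow> s \<le> t \<Longrightarrow> t \<le> T \<Longrightarrow> norm (g t s x) \<le> \<sigma> t s * (1 + norm x)"
begin

text \<open>Coordinate form of the orthogonal projection, from which linearity and continuity can be
  read off; it is matched with \<open>orth_proj\<close> when the result is transferred.\<close>

definition P :: "'h \<Rightarrow> 'h" where "P v = (\<Sum>i\<in>{1..n}. (v \<bullet> e i) *\<^sub>R e i)"

lemma bounded_linear_P: "bounded_linear P"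
  unfolding P_def by (intro bounded_linear_sum bounded_linear_scaleR_const bounded_linear_inner_left)

text \<open>The coordinates of \<open>P v\<close> and v agree, so
  \<open>P v \<bullet> P v = v \<bullet> P v\<close> and Cauchy-Schwarz applies.\<close>

lemma norm_P_le: "norm (P v) \<le> norm v"
proof -
  have coord: "P v \<bullet> e j = v \<bullet> e j" if "j \<in> {1..n}" for j
  proof -
    have "P v \<bullet> e j = (\<Sum>i\<in>{1..n}. if i = j then v \<bullet> e i else 0)"
      unfolding P_def inner_sum_left using that by (intro sum.cong) (auto simp: ortho)
    then show ?thesis using that by simp
  qed
  have "P v \<bullet> P v = (\<Sum>i\<in>{1..n}. (v \<bullet> e i) * (P v \<bullet> e i))"
    by (subst (2) P_def) (simp add: inner_sum_right)
  also have "\<dots> = (\<Sum>i\<in>{1..n}. (v \<bullet> e i) * (v \<bullet> e i))" by (intro sum.cong) (auto simp: coord)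
  also have "\<dots> = v \<bullet> P v" by (simp add: P_def inner_sum_right)
  also have "\<dots> \<le> norm v * norm (P v)" by (rule norm_cauchy_schwarz)
  finally have "norm (P v) * norm (P v) \<le> norm v * norm (P v)"
    by (simp add: power2_norm_eq_inner[symmetric] power2_eq_square)
  then show ?thesis by (cases "P v = 0") auto
qed

section \<open>Selections and the integral operator with memory\<close>

lemma ex_selection: "\<exists>z. \<forall>v. z v \<in> borel_measurable (lebesgue_on {0..T}) \<and>
    (\<forall>t\<in>{0..T}. z v t \<in> F t v \<and> norm (z v t) = Inf (norm ` F t v))"
proof (rule choice, rule allI)
  fix v
  obtain z where "z \<in> borel_measurable (lebesgue_on {0..T})" "\<And>t. t \<in> {0..T} \<Longrightarrow> z t \<in> F t v"
     "\<And>t. t \<in> {0..T} \<Longrightarrow> norm (z t) = Inf (norm ` F t v)"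
    using measurable_minimal_norm_selection[of "lebesgue_on {0..T}" "\<lambda>t. F t v"] F_closed F_convex F_ne F1
    by auto
  then show "\<exists>z. z \<in> borel_measurable (lebesgue_on {0..T}) \<and>
    (\<forall>t\<in>{0..T}. z t \<in> F t v \<and> norm (z t) = Inf (norm ` F t v))" by blast
qed

text \<open>One measurable function of time is fixed for each v separately; nothing is claimed about
  the dependence on v.\<close>

definition sel :: "'h \<Rightarrow> real \<Rightarrow> 'h" where
  "sel = (SOME z. \<forall>v. z v \<in> borel_measurable (lebesgue_on {0..T}) \<and>
    (\<forall>t\<in>{0..T}. z v t \<in> F t v \<and> norm (z v t) = Inf (norm ` F t v)))"

lemma sel_meas: "sel v \<in> borel_measurable (lebesgue_on {0..T})"
  and sel_in: "t \<in> {0..T} \<Longrightarrow> sel v t \<in> F t v"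
  and sel_norm: "t \<in> {0..T} \<Longrightarrow> norm (sel v t) = Inf (norm ` F t v)"
  using someI_ex[OF ex_selection, folded sel_def] by blast+

lemma sel_le: "AE t in lebesgue_on {0..T}. \<forall>v. norm (sel v t) \<le> c t * norm v + d t"
proof -
  have "AE t in lebesgue_on {0..T}. t \<in> {0..T}" by (intro AE_I2) simp
  with F3 show ?thesis by eventually_elim (simp add: sel_norm)
qed

definition G :: "(real \<Rightarrow> 'h) \<Rightarrow> real \<Rightarrow> 'h" where
  "G v t = integral\<^sup>L (lebesgue_on {0..t}) (\<lambda>s. g t s (v s))"

text \<open>For a step function v this is the Euler polygon. It starts at \<open>P x0\<close>, but
  its velocity is not projected, so it may leave the span.\<close>

definition Phi :: "(real \<Rightarrow> 'h) \<Rightarrow> real \<Rightarrow> 'h" where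
  "Phi v t = P x0 + integral\<^sup>L (lebesgue_on {0..t}) (\<lambda>s. sel (v s) s + G v s)"

text \<open>Both the selection and the memory term look only backwards; this allows nodes to be
  determined one after another.\<close>

lemma Phi_causal:
  assumes "\<And>s. s \<in> {0..t} \<Longrightarrow> v s = v' s" shows "Phi v t = Phi v' t"
proof -
  have "G v s = G v' s" if "s \<in> {0..t}" for s
    unfolding G_def using that assms by (intro Bochner_Integration.integral_cong) auto
  then show ?thesis
    unfolding Phi_def using assms by (intro arg_cong2[where f="(+)"] Bochner_Integration.integral_cong) auto
qed

lemma norm_G_le:
  assumes t: "0 \<le> t" "t \<le> T"
    and "integrable (lebesgue_on {0..t}) (\<lambda>s. g t s (v s))"
    and "integrable (lebesgue_on {0..t}) (\<lambda>s. \<sigma> t s * (1 + \<rho> s))"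
    and "\<And>s. s \<in> {0..t} \<Longrightarrow> norm (v s) \<le> \<rho> s"
  shows "norm (G v t) \<le> integral\<^sup>L (lebesgue_on {0..t}) (\<lambda>s. \<sigma> t s * (1 + \<rho> s))"
  unfolding G_def
proof (rule Bochner_Integration.integral_norm_bound_integral[OF assms(3,4)])
  fix s assume "s \<in> space (lebesgue_on {0..t})"
  then have s: "0 \<le> s" "s \<le> t" "norm (v s) \<le> \<rho> s" using assms(5) by auto
  have "norm (g t s (v s)) \<le> \<sigma> t s * (1 + norm (v s))" using g3 s t by simp
  also have "\<dots> \<le> \<sigma> t s * (1 + \<rho> s)" using s t by (intro mult_left_mono \<sigma>_nn) auto
  finally show "norm (g t s (v s)) \<le> \<sigma> t s * (1 + \<rho> s)" .
qed

text \<open>Cells are open on the left: times in the interval from \<open>h * i\<close> (excluded)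
  to \<open>h * (i + 1)\<close> (included) get index i, and \<open>nat\<close> sends time 0 to index
  0. Hence the polygon up to a grid point uses only nodes with smaller index.\<close>

definition idx :: "real \<Rightarrow> real \<Rightarrow> nat" where "idx h t = nat (\<lceil>t / h\<rceil> - 1)"

lemma idx_le:
  assumes "h > 0" "0 \<le> t" shows "h * real (idx h t) \<le> t" "t \<le> h * real (idx h t) + h"
proof -
  have c: "t / h \<le> of_int \<lceil>t / h\<rceil>" "of_int \<lceil>t / h\<rceil> < t / h + 1" by linarith+
  consider "\<lceil>t / h\<rceil> \<ge> 1" | "\<lceil>t / h\<rceil> \<le> 0" by linarith
  then have "real (idx h t) \<le> t / h \<and> t / h \<le> real (idx h t) + 1"
  proof cases
    case 1
    then have "real (idx h t) = of_int \<lceil>t / h\<rceil> - 1" unfolding idx_def by simp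
    with c show ?thesis by simp
  next
    case 2
    then have "real (idx h t) = 0" unfolding idx_def by simp
    moreover have "t / h \<le> 0" "0 \<le> t / h" using c(1) 2 assms by (auto intro: order_trans)
    ultimately show ?thesis by linarith
  qed
  then show "h * real (idx h t) \<le> t" "t \<le> h * real (idx h t) + h"
    using assms by (simp_all add: field_simps)
qed

lemma idx_le_nat:
  assumes "h > 0" "t \<le> h * real (Suc j)" shows "idx h t \<le> j"
proof -
  have "t / h \<le> real (Suc j)" using assms by (simp add: field_simps)
  then have "\<lceil>t / h\<rceil> \<le> int (Suc j)" by (simp add: ceiling_le_iff)
  then show ?thesis unfolding idx_def by simp
qed

lemma idx_measurable [measurable]: "idx h \<in> measurable borel (count_space UNIV)"
  unfolding idx_def by measurable

text \<open>The nodes satisfy an implicit equation, since the polygon through which a node is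
  defined is driven by the nodes. Causality makes it solvable, by induction on the number of cells
  covered.\<close>

lemma euler_exists:
  assumes "h > 0"
  obtains w where "\<And>t. t \<in> {0..T} \<Longrightarrow> w (idx h t) = P (Phi (\<lambda>s. w (idx h s)) (h * real (idx h t)))"
proof -
  have "\<exists>w. \<forall>t. 0 \<le> t \<longrightarrow> t \<le> h * real j \<longrightarrow> w (idx h t) = P (Phi (\<lambda>s. w (idx h s)) (h * real (idx h t)))" for j
  proof (induction j)
    case 0
    have "idx h 0 = 0" by (simp add: idx_def)
    \<comment> \<open>Only time 0 is concerned; there the integral is zero and the right-hand side
      reads \<open>P (P x0)\<close>.\<close>
    then show ?case by (intro exI[of _ "\<lambda>_. P (P x0)"]) (auto simp: Phi_def)
  next
    case (Suc j)
    then obtain w where w: "\<And>t. 0 \<le> t \<Longrightarrow> t \<le> h * real j \<Longrightarrow> w (idx h t) = P (Phi (\<lambda>s. w (idx h s)) (h * real (idx h t)))"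
      by blast
    \<comment> \<open>All nodes are recomputed from the old ones. By the induction hypothesis
      nothing changes at times up to \<open>h * real j\<close>, and the polygon at the nodes of the
      enlarged range sees only those times.\<close>
    define w' where "w' i = P (Phi (\<lambda>s. w (idx h s)) (h * real i))" for i
    have "w' (idx h t) = P (Phi (\<lambda>s. w' (idx h s)) (h * real (idx h t)))" if "0 \<le> t" "t \<le> h * real (Suc j)" for t
    proof -
      have "h * real (idx h t) \<le> h * real j" using idx_le_nat[OF assms that(2)] assms by simp
      then have "Phi (\<lambda>s. w (idx h s)) (h * real (idx h t)) = Phi (\<lambda>s. w' (idx h s)) (h * real (idx h t))"
        by (intro Phi_causal) (auto simp: w'_def intro!: w)
      then show ?thesis by (simp add: w'_def)
    qed
    then show ?case by blast
  qed
  moreover obtain j where "T / h \<le> real j" using real_arch_simple by blast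
  then have "T \<le> h * real j" using assms by (simp add: field_simps)
  ultimately show ?thesis using that by (metis atLeastAtMost_iff order_trans)
qed

text \<open>The step function takes countably many values on measurable pieces, so measurability of
  \<open>sel v\<close> for each single v is enough.\<close>

lemma step_sel_meas: "(\<lambda>s. sel (w (idx h s)) s) \<in> borel_measurable (lebesgue_on {0..T})"
proof (rule measurable_compose_countable[of "\<lambda>i s. sel (w i) s"])
  show "idx h \<in> measurable (lebesgue_on {0..T}) (count_space UNIV)"
    by (intro measurable_restrict_space1 measurable_completion) simp
qed (rule sel_meas)

text \<open>Only the second time variable enters the index, so again countably many measurable
  functions are glued; the growth condition supplies the majorant
  \<open>(1 + R) * \<sigma> t s\<close>.\<close>

lemma step_g_int:
  assumes R: "\<And>s. s \<in> {0..T} \<Longrightarrow> norm (w (idx h s)) \<le> R"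
  shows "integrable (lebesgue_on {(t, s). 0 \<le> s \<and> s \<le> t \<and> t \<le> T}) (\<lambda>(t, s). g t s (w (idx h s)))"
proof (rule Bochner_Integration.integrable_bound)
  let ?D = "{(t, s). 0 \<le> s \<and> s \<le> t \<and> t \<le> T}"
  show "integrable (lebesgue_on ?D) (\<lambda>p. (1 + R) * (case p of (t, s) \<Rightarrow> \<sigma> t s))"
    using \<sigma>_int by simp
  have "(\<lambda>p. g (fst p) (snd p) (w (idx h (snd p)))) \<in> borel_measurable (lebesgue_on ?D)"
  proof (rule measurable_compose_countable[of "\<lambda>i p. g (fst p) (snd p) (w i)"])
    have [measurable]: "(\<lambda>p :: real \<times> real. snd p) \<in> measurable borel borel"
      by (intro borel_measurable_continuous_onI continuous_intros)
    have "(\<lambda>p :: real \<times> real. idx h (snd p)) \<in> measurable borel (count_space UNIV)" by measurable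
    then show "(\<lambda>p :: real \<times> real. idx h (snd p)) \<in> measurable (lebesgue_on ?D) (count_space UNIV)"
      by (intro measurable_restrict_space1 measurable_completion) simp
    fix i
    have "(\<lambda>(t, s). g t s (w i)) \<in> borel_measurable (lebesgue_on ?D)"
      using g1 by (rule measurable_restrict_mono) auto
    then show "(\<lambda>p. g (fst p) (snd p) (w i)) \<in> borel_measurable (lebesgue_on ?D)"
      by (simp add: case_prod_beta')
  qed
  then show "(\<lambda>(t, s). g t s (w (idx h s))) \<in> borel_measurable (lebesgue_on ?D)"
    by (simp add: case_prod_beta')
  show "AE p in lebesgue_on ?D. norm (case p of (t, s) \<Rightarrow> g t s (w (idx h s)))
      \<le> norm ((1 + R) * (case p of (t, s) \<Rightarrow> \<sigma> t s))"
  proof (intro AE_I2)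
    fix p assume "p \<in> space (lebesgue_on ?D)"
    then obtain t s where p: "p = (t, s)" "0 \<le> s" "s \<le> t" "t \<le> T" by auto
    have "norm (g t s (w (idx h s))) \<le> \<sigma> t s * (1 + norm (w (idx h s)))" using g3 p by simp
    also have "\<dots> \<le> \<sigma> t s * (1 + R)" using p R[of s] by (intro mult_left_mono \<sigma>_nn) auto
    also have "\<dots> \<le> norm ((1 + R) * \<sigma> t s)" by (simp add: mult.commute)
    finally show "norm (case p of (t, s) \<Rightarrow> g t s (w (idx h s))) \<le> norm ((1 + R) * (case p of (t, s) \<Rightarrow> \<sigma> t s))"
      using p by simp
  qed
qed

end

section \<open>A priori estimates for one polygon\<close>

locale euler_polygon = projected_inclusion T x0 c d \<sigma> e n F g
  for T :: real and x0 :: "'h::{real_inner, banach, second_countable_topology}"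
    and c d \<sigma> e n F g +
  fixes h :: real and w :: "nat \<Rightarrow> 'h"
  assumes h_pos: "h > 0"
    and fixpoint: "\<And>t. t \<in> {0..T} \<Longrightarrow> w (idx h t) = P (Phi (\<lambda>s. w (idx h s)) (h * real (idx h t)))"
begin

abbreviation "v \<equiv> \<lambda>s. w (idx h s)"

text \<open>Only finitely many indices occur on \<open>{0..T}\<close>. This crude bound secures
  integrability of the velocity, which the sharp estimate by r presupposes.\<close>

lemma v_bounded: "\<exists>R. \<forall>s\<in>{0..T}. norm (v s) \<le> R"
proof -
  obtain j where "T / h \<le> real j" using real_arch_simple by blast
  then have j: "T \<le> h * real (Suc j)" using h_pos by (simp add: field_simps)
  show ?thesis
  proof (intro exI ballI)
    fix s assume "s \<in> {0..T}"
    then have "idx h s \<le> j" using j by (intro idx_le_nat h_pos) simp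
    then show "norm (v s) \<le> (\<Sum>i\<le>j. norm (w i))" by (intro member_le_sum) auto
  qed
qed

lemma g_slice: "AE t in lebesgue_on {0..T}. integrable (lebesgue_on {0..t}) (\<lambda>s. g t s (v s))"
  and G_int: "integrable (lebesgue_on {0..T}) (G v)"
proof -
  obtain R where "\<And>s. s \<in> {0..T} \<Longrightarrow> norm (v s) \<le> R" using v_bounded by blast
  then have "integrable (lebesgue_on {(t, s). 0 \<le> s \<and> s \<le> t \<and> t \<le> T}) (\<lambda>(t, s). g t s (v s))"
    by (rule step_g_int[where w=w and h=h and R=R])
  then show "AE t in lebesgue_on {0..T}. integrable (lebesgue_on {0..t}) (\<lambda>s. g t s (v s))"
    and "integrable (lebesgue_on {0..T}) (G v)"
    unfolding G_def by (auto dest: Fubini_triangle)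
qed

lemma sel_int: "integrable (lebesgue_on {0..T}) (\<lambda>s. sel (v s) s)"
proof -
  obtain R where R: "\<And>s. s \<in> {0..T} \<Longrightarrow> norm (v s) \<le> R" using v_bounded by blast
  show ?thesis
  proof (rule Bochner_Integration.integrable_bound)
    show "integrable (lebesgue_on {0..T}) (\<lambda>t. c t * R + d t)" using c_int d_int by simp
    have "AE t in lebesgue_on {0..T}. t \<in> {0..T}" by (intro AE_I2) simp
    with sel_le show "AE t in lebesgue_on {0..T}. norm (sel (v t) t) \<le> norm (c t * R + d t)"
    proof eventually_elim
      case (elim t)
      have "norm (sel (v t) t) \<le> c t * norm (v t) + d t" using elim by blast
      also have "\<dots> \<le> c t * R + d t" using R c_nn elim by (intro add_mono mult_left_mono) auto
      finally show ?case by simp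
    qed
  qed (rule step_sel_meas)
qed

lemma velocity_int: "integrable (lebesgue_on {0..T}) (\<lambda>s. sel (v s) s + G v s)"
  using sel_int G_int by simp

lemma Phi_diff:
  assumes "0 \<le> s" "s \<le> t" "t \<le> T"
  shows "Phi v t - Phi v s = integral\<^sup>L (lebesgue_on {s..t}) (\<lambda>s. sel (v s) s + G v s)"
  using integral_lebesgue_on_split[OF integrable_lebesgue_on_subinterval[OF velocity_int, of 0 t], of s] assms
  by (simp add: Phi_def)

text \<open>The selection contributes \<open>c s * \<rho> + d s\<close> and the memory term
  \<open>\<Sigma> s * (1 + \<rho>)\<close>. The bound on v is demanded on all of
  \<open>{0..t}\<close> because \<open>G v s\<close> reaches back to time 0.\<close>

lemma norm_velocity_le:
  assumes t: "0 \<le> t" "t \<le> T" and \<rho>: "\<And>s. s \<in> {0..t} \<Longrightarrow> norm (v s) \<le> \<rho>"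
  shows "AE s in lebesgue_on {0..t}. norm (sel (v s) s + G v s) \<le> \<rho> * (c s + \<Sigma> s) + (d s + \<Sigma> s)"
proof -
  have "AE s in lebesgue_on {0..T}. s \<in> {0..T}" by (intro AE_I2) simp
  with g_slice \<sigma>_slice sel_le
  have "AE s in lebesgue_on {0..T}. s \<le> t \<longrightarrow> norm (sel (v s) s + G v s) \<le> \<rho> * (c s + \<Sigma> s) + (d s + \<Sigma> s)"
  proof eventually_elim
    case (elim s)
    show ?case
    proof
      assume st: "s \<le> t"
      have "norm (G v s) \<le> integral\<^sup>L (lebesgue_on {0..s}) (\<lambda>u. \<sigma> s u * (1 + \<rho>))"
        using elim st \<rho> by (intro norm_G_le) auto
      also have "\<dots> = \<Sigma> s * (1 + \<rho>)"
        unfolding inner_sigma_def by (rule integral_mult_left_zero)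
      finally have G: "norm (G v s) \<le> \<Sigma> s * (1 + \<rho>)" .
      have "norm (sel (v s) s) \<le> c s * norm (v s) + d s" using elim by blast
      also have "\<dots> \<le> c s * \<rho> + d s" using \<rho>[of s] c_nn elim st by (intro add_mono mult_left_mono) auto
      finally have "norm (sel (v s) s) \<le> c s * \<rho> + d s" .
      then have "norm (sel (v s) s + G v s) \<le> c s * \<rho> + d s + \<Sigma> s * (1 + \<rho>)"
        using G norm_triangle_ineq[of "sel (v s) s" "G v s"] by linarith
      then show "norm (sel (v s) s + G v s) \<le> \<rho> * (c s + \<Sigma> s) + (d s + \<Sigma> s)"
        by (simp add: algebra_simps)
    qed
  qed
  then have "AE s in lebesgue_on {0..t}. s \<le> t \<longrightarrow> norm (sel (v s) s + G v s) \<le> \<rho> * (c s + \<Sigma> s) + (d s + \<Sigma> s)"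
    by (rule AE_lebesgue_on_subinterval) (use t in auto)
  moreover have "AE s in lebesgue_on {0..t}. s \<le> t" by (intro AE_I2) simp
  ultimately show ?thesis by eventually_elim simp
qed

text \<open>Two choices of \<rho> matter: \<open>r s\<close> reproduces the increment in
  \<open>r_step\<close>, and \<open>r T\<close> gives a modulus of continuity common to all
  polygons.\<close>

lemma norm_Phi_diff_le:
  assumes st: "0 \<le> s" "s \<le> t" "t \<le> T" and \<rho>: "\<And>u. u \<in> {0..t} \<Longrightarrow> norm (v u) \<le> \<rho>"
  shows "norm (Phi v t - Phi v s) \<le> \<rho> * integral\<^sup>L (lebesgue_on {s..t}) (\<lambda>u. c u + \<Sigma> u)
      + integral\<^sup>L (lebesgue_on {s..t}) (\<lambda>u. d u + \<Sigma> u)"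
proof -
  have i: "integrable (lebesgue_on {s..t}) (\<lambda>u. sel (v u) u + G v u)"
    "integrable (lebesgue_on {s..t}) (\<lambda>u. c u + \<Sigma> u)" "integrable (lebesgue_on {s..t}) (\<lambda>u. d u + \<Sigma> u)"
    using st by (auto intro!: integrable_lebesgue_on_subinterval[OF velocity_int]
        integrable_lebesgue_on_subinterval[OF rate_int] integrable_lebesgue_on_subinterval[OF forcing_int])
  have "norm (Phi v t - Phi v s) \<le> integral\<^sup>L (lebesgue_on {s..t}) (\<lambda>u. norm (sel (v u) u + G v u))"
    unfolding Phi_diff[OF st] by (rule integral_norm_bound)
  also have "\<dots> \<le> integral\<^sup>L (lebesgue_on {s..t}) (\<lambda>u. \<rho> * (c u + \<Sigma> u) + (d u + \<Sigma> u))"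
  proof (rule integral_mono_AE)
    have "AE u in lebesgue_on {0..t}. norm (sel (v u) u + G v u) \<le> \<rho> * (c u + \<Sigma> u) + (d u + \<Sigma> u)"
      by (rule norm_velocity_le) (use st \<rho> in auto)
    then show "AE u in lebesgue_on {s..t}. norm (sel (v u) u + G v u) \<le> \<rho> * (c u + \<Sigma> u) + (d u + \<Sigma> u)"
      by (rule AE_lebesgue_on_subinterval) (use st in auto)
  qed (intro Bochner_Integration.integrable_norm Bochner_Integration.integrable_add integrable_mult_right i)+
  also have "\<dots> = \<rho> * integral\<^sup>L (lebesgue_on {s..t}) (\<lambda>u. c u + \<Sigma> u) + integral\<^sup>L (lebesgue_on {s..t}) (\<lambda>u. d u + \<Sigma> u)"
    by (subst Bochner_Integration.integral_add) (auto simp only: integral_mult_right_zero intro!: integrable_mult_right i)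
  finally show ?thesis .
qed

lemma norm_Phi_le:
  assumes "t \<in> {0..T}" shows "norm (Phi v t) \<le> r t"
proof -
  have "\<forall>t\<in>{0..T}. t \<le> h * real j \<longrightarrow> norm (Phi v t) \<le> r t" for j
  proof (induction j)
    case 0
    show ?case using norm_P_le[of x0] by (auto simp: Phi_def r_0)
  next
    case (Suc j)
    show ?case
    proof (intro ballI impI)
      fix t assume t: "t \<in> {0..T}" "t \<le> h * real (Suc j)"
      show "norm (Phi v t) \<le> r t"
      proof (cases "t \<le> h * real j")
        case True
        then show ?thesis using Suc t by blast
      next
        case False
        define s where "s = h * real j"
        have s: "0 \<le> s" "s \<le> t" "t \<le> T" using False h_pos t by (auto simp: s_def)
        have vs: "norm (v u) \<le> r s" if u: "u \<in> {0..t}" for u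
        proof -
          have q: "h * real (idx h u) \<le> s" "0 \<le> h * real (idx h u)"
            using idx_le_nat[OF h_pos, of u j] u t h_pos by (auto simp: s_def)
          have "norm (v u) \<le> norm (Phi v (h * real (idx h u)))"
            using fixpoint[of u] u t norm_P_le by simp
          also have "\<dots> \<le> r (h * real (idx h u))" using Suc q s by (auto simp: s_def)
          also have "\<dots> \<le> r s" using q s by (intro r_mono) auto
          finally show ?thesis .
        qed
        have "norm (Phi v t) \<le> norm (Phi v s) + norm (Phi v t - Phi v s)"
          by (metis add.commute diff_add_cancel norm_triangle_ineq)
        also have "\<dots> \<le> r s + (r s * integral\<^sup>L (lebesgue_on {s..t}) (\<lambda>u. c u + \<Sigma> u)
            + integral\<^sup>L (lebesgue_on {s..t}) (\<lambda>u. d u + \<Sigma> u))"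
          using Suc s by (intro add_mono norm_Phi_diff_le vs) (auto simp: s_def)
        also have "\<dots> \<le> r t" using r_step[OF s] by simp
        finally show ?thesis .
      qed
    qed
  qed
  moreover obtain j where "T / h \<le> real j" using real_arch_simple by blast
  then have "T \<le> h * real j" using h_pos by (simp add: field_simps)
  ultimately show ?thesis using assms by (meson atLeastAtMost_iff order_trans)
qed

lemma norm_v_le:
  assumes t: "t \<in> {0..T}" shows "norm (v t) \<le> r t"
proof -
  have q: "h * real (idx h t) \<le> t" "0 \<le> h * real (idx h t)"
    using idx_le[OF h_pos, of t] t h_pos by auto
  have "norm (v t) \<le> norm (Phi v (h * real (idx h t)))"
    using fixpoint[of t] t norm_P_le by simp
  also have "\<dots> \<le> r (h * real (idx h t))" using q t by (intro norm_Phi_le) auto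
  also have "\<dots> \<le> r t" using q t by (intro r_mono) auto
  finally show ?thesis .
qed

lemma norm_sel_le: "AE t in lebesgue_on {0..T}. norm (sel (v t) t) \<le> c t * r t + d t"
proof -
  have "AE t in lebesgue_on {0..T}. t \<in> {0..T}" by (intro AE_I2) simp
  with sel_le show ?thesis
  proof eventually_elim
    case (elim t)
    have "norm (sel (v t) t) \<le> c t * norm (v t) + d t" using elim by blast
    also have "\<dots> \<le> c t * r t + d t" using norm_v_le[of t] c_nn elim by (intro add_mono mult_left_mono) auto
    finally show ?case .
  qed
qed

end

section \<open>Passage to the limit\<close>

context projected_inclusion
begin

text \<open>Adding the coordinate index as a second variable reduces to real-valued functions on a compact set.\<close>

lemma projected_subsequence:
  fixes X :: "nat \<Rightarrow> real \<Rightarrow> 'h"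
  assumes bound: "\<And>k t. t \<in> {0..T} \<Longrightarrow> norm (X k t) \<le> B"
    and \<Psi>: "continuous_on {0..T} \<Psi>"
    and equi: "\<And>k s t. s \<in> {0..T} \<Longrightarrow> t \<in> {0..T} \<Longrightarrow> norm (X k t - X k s) \<le> \<bar>\<Psi> t - \<Psi> s\<bar>"
  shows "\<exists>\<kappa> y. strict_mono \<kappa> \<and> (\<forall>t\<in>{0..T}. (\<lambda>k. P (X (\<kappa> k) t)) \<longlonglongrightarrow> y t)"
proof -
  define S :: "(real \<times> real) set" where "S = {0..T} \<times> real ` {1..n}"
  define f where "f k p = X k (fst p) \<bullet> e (nat \<lfloor>snd p\<rfloor>)" for k and p :: "real \<times> real"
  have S: "compact S" unfolding S_def by (rule compact_Times[OF compact_Icc finite_imp_compact]) simp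
  have ne: "norm (e i) = 1" if "i \<in> {1..n}" for i using ortho[OF that that] by (simp add: norm_eq_1)
  have inner_le: "\<bar>u \<bullet> e i\<bar> \<le> norm u" if "i \<in> {1..n}" for u i
    using Cauchy_Schwarz_ineq2[of u "e i"] ne[OF that] by simp
  have fb: "norm (f k p) \<le> B" if pS: "p \<in> S" for k p
  proof -
    obtain t i where p: "p = (t, real i)" "t \<in> {0..T}" "i \<in> {1..n}" using pS by (auto simp: S_def)
    show ?thesis using inner_le[OF p(3), of "X k t"] bound[OF p(2), of k] by (simp add: f_def p(1))
  qed
  have fe: "\<exists>\<delta>>0. \<forall>k q. q \<in> S \<and> norm (p - q) < \<delta> \<longrightarrow> norm (f k p - f k q) < \<epsilon>" if pS: "p \<in> S" and \<epsilon>: "\<epsilon> > 0" for p \<epsilon>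
  proof -
    obtain t i where p: "p = (t, real i)" "t \<in> {0..T}" "i \<in> {1..n}" using pS by (auto simp: S_def)
    obtain \<delta> where "\<delta> > 0" and \<delta>: "\<And>s. s \<in> {0..T} \<Longrightarrow> dist s t < \<delta> \<Longrightarrow> dist (\<Psi> s) (\<Psi> t) < \<epsilon>"
      using \<Psi> p(2) \<epsilon> unfolding continuous_on_iff by blast
    \<comment> \<open>Indices are embedded as integers, so points closer than 1 share the coordinate
      and only the time variation remains.\<close>
    have "norm (f k p - f k q) < \<epsilon>" if qS: "q \<in> S" and pq: "norm (p - q) < min \<delta> 1" for k q
    proof -
      obtain s j where q: "q = (s, real j)" "s \<in> {0..T}" "j \<in> {1..n}" using qS by (auto simp: S_def)
      have 1: "\<bar>t - s\<bar> < \<delta>" "\<bar>real i - real j\<bar> < 1"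
        using norm_fst_le[of "t - s" "real i - real j"] norm_snd_le[of "real i - real j" "t - s"] pq p q by auto
      have "i = j" using 1(2) by linarith
      have "norm (f k p - f k q) = \<bar>(X k t - X k s) \<bullet> e i\<bar>"
        using p q \<open>i = j\<close> by (simp add: f_def inner_diff_left)
      also have "\<dots> \<le> norm (X k t - X k s)" by (rule inner_le[OF p(3)])
      also have "\<dots> \<le> \<bar>\<Psi> t - \<Psi> s\<bar>" by (rule equi[OF q(2) p(2)])
      also have "\<dots> < \<epsilon>" using \<delta>[OF q(2)] 1 by (simp add: dist_real_def abs_minus_commute)
      finally show ?thesis .
    qed
    then show ?thesis using \<open>\<delta> > 0\<close> by (intro exI[of _ "min \<delta> 1"]) auto
  qed
  have "\<exists>y' (\<kappa> :: nat \<Rightarrow> nat). strict_mono \<kappa> \<and>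
      (\<forall>\<epsilon>>0. \<exists>N. \<forall>k p. k \<ge> N \<and> p \<in> S \<longrightarrow> norm (f (\<kappa> k) p - y' p) < \<epsilon>)"
  proof (rule Arzela_Ascoli[OF S fb fe])
    fix y' and \<kappa> :: "nat \<Rightarrow> nat"
    assume "strict_mono \<kappa>" "\<And>\<epsilon>. 0 < \<epsilon> \<Longrightarrow> \<exists>N. \<forall>k p. k \<ge> N \<and> p \<in> S \<longrightarrow> norm (f (\<kappa> k) p - y' p) < \<epsilon>"
    then show ?thesis by (intro exI[of _ y'] exI[of _ \<kappa>]) simp
  qed
  then obtain y' and \<kappa> :: "nat \<Rightarrow> nat" where \<kappa>: "strict_mono \<kappa>"
    and lim: "\<forall>\<epsilon>>0. \<exists>N. \<forall>k p. k \<ge> N \<and> p \<in> S \<longrightarrow> norm (f (\<kappa> k) p - y' p) < \<epsilon>"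
    by (elim exE conjE)
  have coord: "(\<lambda>k. X (\<kappa> k) t \<bullet> e i) \<longlonglongrightarrow> y' (t, real i)" if "t \<in> {0..T}" "i \<in> {1..n}" for t i
  proof (rule LIMSEQ_I)
    fix \<epsilon> :: real assume "\<epsilon> > 0"
    with lim obtain N where N: "\<And>k p. k \<ge> N \<and> p \<in> S \<Longrightarrow> norm (f (\<kappa> k) p - y' p) < \<epsilon>" by blast
    have "(t, real i) \<in> S" using that by (auto simp: S_def)
    then have "norm (X (\<kappa> k) t \<bullet> e i - y' (t, real i)) < \<epsilon>" if "k \<ge> N" for k
      using N[of k "(t, real i)"] that by (simp add: f_def)
    then show "\<exists>N. \<forall>k\<ge>N. norm (X (\<kappa> k) t \<bullet> e i - y' (t, real i)) < \<epsilon>" by blast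
  qed
  show ?thesis
  proof (intro exI conjI ballI)
    show "strict_mono \<kappa>" by fact
    fix t assume "t \<in> {0..T}"
    then show "(\<lambda>k. P (X (\<kappa> k) t)) \<longlonglongrightarrow> (\<Sum>i\<in>{1..n}. y' (t, real i) *\<^sub>R e i)"
      unfolding P_def by (intro tendsto_sum tendsto_scaleR coord tendsto_const)
  qed
qed

lemma G_tendsto:
  assumes t: "0 \<le> t" "t \<le> T"
    and \<sigma>: "integrable (lebesgue_on {0..t}) (\<sigma> t)"
    and gk: "\<And>k. integrable (lebesgue_on {0..t}) (\<lambda>s. g t s (u k s))"
    and le: "\<And>k s. s \<in> {0..t} \<Longrightarrow> norm (u k s) \<le> r s"
    and lim: "\<And>s. s \<in> {0..t} \<Longrightarrow> (\<lambda>k. u k s) \<longlonglongrightarrow> y s"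
  shows "(\<lambda>k. G (u k) t) \<longlonglongrightarrow> G y t" and "integrable (lebesgue_on {0..t}) (\<lambda>s. g t s (y s))"
proof -
  have glim: "(\<lambda>k. g t s (u k s)) \<longlonglongrightarrow> g t s (y s)" if "s \<in> {0..t}" for s
    using g2[of s t] lim[OF that] that t by (intro continuous_on_tendsto_compose[of UNIV "g t s"]) auto
  have w: "integrable (lebesgue_on {0..t}) (\<lambda>s. \<sigma> t s * (1 + r s))"
    using \<sigma> \<sigma>_r_int[OF t \<sigma>] by (simp add: distrib_left)
  have m: "(\<lambda>s. g t s (y s)) \<in> borel_measurable (lebesgue_on {0..t})"
    by (rule borel_measurable_LIMSEQ_metric[of "\<lambda>k s. g t s (u k s)"]) (use gk glim in auto)
  have l: "AE s in lebesgue_on {0..t}. (\<lambda>k. g t s (u k s)) \<longlonglongrightarrow> g t s (y s)"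
    by (intro AE_I2 glim) simp
  have b: "AE s in lebesgue_on {0..t}. norm (g t s (u k s)) \<le> \<sigma> t s * (1 + r s)" for k
  proof (intro AE_I2)
    fix s assume "s \<in> space (lebesgue_on {0..t})"
    then have s: "0 \<le> s" "s \<le> t" by auto
    have "norm (g t s (u k s)) \<le> \<sigma> t s * (1 + norm (u k s))" using g3 s t by simp
    also have "\<dots> \<le> \<sigma> t s * (1 + r s)" using s t le[of s k] by (intro mult_left_mono \<sigma>_nn) auto
    finally show "norm (g t s (u k s)) \<le> \<sigma> t s * (1 + r s)" .
  qed
  show "(\<lambda>k. G (u k) t) \<longlonglongrightarrow> G y t"
    unfolding G_def by (rule integral_dominated_convergence[OF m borel_measurable_integrable[OF gk] w l b])
  show "integrable (lebesgue_on {0..t}) (\<lambda>s. g t s (y s))"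
    by (rule integrable_dominated_convergence[OF m borel_measurable_integrable[OF gk] w l b])
qed

text \<open>A separating half-space would contain \<open>F t (u j)\<close> for all large j, hence
  the tail combinations too. The strict inequality weakens to a closed one in the limit, which still
  contradicts the gap at l.\<close>

lemma limit_in_values:
  assumes t: "t \<in> {0..T}"
    and usc: "\<forall>v p \<alpha>. (\<forall>w\<in>F t v. w \<bullet> p < \<alpha>) \<longrightarrow> (\<exists>\<delta>>0. \<forall>u. dist u v < \<delta> \<longrightarrow> (\<forall>w\<in>F t u. w \<bullet> p < \<alpha>))"
    and mem: "\<And>j. a j \<in> F t (u j)" and u: "u \<longlonglongrightarrow> y"
    and w: "\<And>k. tail_weights k (A k) (\<mu> k)"
    and lim: "(\<lambda>k. \<Sum>j\<in>A k. \<mu> k j *\<^sub>R a j) \<longlonglongrightarrow> l"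
  shows "l \<in> F t y"
proof (rule ccontr)
  assume "l \<notin> F t y"
  then obtain p \<alpha> where p: "\<And>w. w \<in> F t y \<Longrightarrow> w \<bullet> p < \<alpha>" "\<alpha> < l \<bullet> p"
    using closed_convex_separate_point[OF F_closed[OF t] F_convex[OF t]] by metis
  then obtain \<delta> where "\<delta> > 0" and \<delta>: "\<And>u w. dist u y < \<delta> \<Longrightarrow> w \<in> F t u \<Longrightarrow> w \<bullet> p < \<alpha>"
    using usc by metis
  obtain N where N: "\<And>j. j \<ge> N \<Longrightarrow> dist (u j) y < \<delta>"
    using u \<open>\<delta> > 0\<close> metric_LIMSEQ_D by blast
  have conv: "convex {z. p \<bullet> z \<le> \<alpha>}" by (rule convex_halfspace_le)
  have "(\<Sum>j\<in>A k. \<mu> k j *\<^sub>R a j) \<in> {z. p \<bullet> z \<le> \<alpha>}" if "k \<ge> N" for k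
    using w[of k] conv
  proof (rule tail_weights_convex)
    fix j assume "j \<ge> k"
    then have "a j \<bullet> p < \<alpha>" using \<delta>[OF N mem] that by simp
    then show "a j \<in> {z. p \<bullet> z \<le> \<alpha>}" by (simp add: inner_commute)
  qed
  then have "eventually (\<lambda>k. p \<bullet> (\<Sum>j\<in>A k. \<mu> k j *\<^sub>R a j) \<le> \<alpha>) sequentially"
    unfolding eventually_sequentially by blast
  moreover have "(\<lambda>k. p \<bullet> (\<Sum>j\<in>A k. \<mu> k j *\<^sub>R a j)) \<longlonglongrightarrow> p \<bullet> l"
    by (intro tendsto_inner tendsto_const lim)
  ultimately have "p \<bullet> l \<le> \<alpha>" by (intro tendsto_upperbound) auto
  then show False using p(2) by (simp add: inner_commute)
qed

end

lemma tail_weights_limit_norm_le: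
  fixes a :: "nat \<Rightarrow> 'h::real_normed_vector"
  assumes w: "\<And>k. tail_weights k (A k) (\<mu> k)" and "\<And>j. norm (a j) \<le> B"
    and lim: "(\<lambda>k. \<Sum>j\<in>A k. \<mu> k j *\<^sub>R a j) \<longlonglongrightarrow> l"
  shows "norm l \<le> B"
proof -
  have "(\<Sum>j\<in>A k. \<mu> k j *\<^sub>R a j) \<in> cball 0 B" for k
    using w[of k] by (rule tail_weights_convex) (use assms(2) in auto)
  then have "l \<in> cball 0 B" by (intro closed_sequentially[OF closed_cball _ lim]) blast
  then show ?thesis by simp
qed

context projected_inclusion
begin

theorem solution_exists:
  "\<exists>x. AC_on T x \<and> x 0 = P x0 \<and>
      (AE t in lebesgue_on {0..T}.
          x differentiable (at t within {0..T}) \<and>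
          vector_derivative x (at t within {0..T}) \<in>
            (\<lambda>w. w + integral\<^sup>L (lebesgue_on {0..t}) (\<lambda>s. g t s (P (x s)))) ` F t (P (x t))) \<and>
      (\<forall>t\<in>{0..T}. norm (x t) \<le> r t) \<and>
      (AE t in lebesgue_on {0..T}.
          norm (vector_derivative x (at t within {0..T})) \<le> psi_fun (norm x0) c d \<sigma> t)"
proof -
  have inT: "AE t in lebesgue_on {0..T}. t \<in> {0..T}" by (intro AE_I2) simp
  have rT: "r s \<le> r T" if "s \<in> {0..T}" for s using that by (intro r_mono) auto
  define h where "h k = 1 / real (Suc k)" for k
  have h: "h k > 0" for k by (simp add: h_def)
  have "\<exists>w. \<forall>t\<in>{0..T}. w (idx (h k) t) = P (Phi (\<lambda>s. w (idx (h k) s)) (h k * real (idx (h k) t)))" for k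
    using euler_exists[OF h, of k] by metis
  then obtain w where fixp: "\<And>k t. t \<in> {0..T} \<Longrightarrow>
      w k (idx (h k) t) = P (Phi (\<lambda>s. w k (idx (h k) s)) (h k * real (idx (h k) t)))" by metis
  have E: "euler_polygon T x0 c d \<sigma> e n F g (h k) (w k)" for k
    by (intro euler_polygon.intro euler_polygon_axioms.intro projected_inclusion_axioms h fixp)
  define V where "V k = (\<lambda>s. w k (idx (h k) s))" for k
  define X where "X k = Phi (V k)" for k
  have V_le: "norm (V k t) \<le> r t" if "t \<in> {0..T}" for k t
    using euler_polygon.norm_v_le[OF E that, of k] by (simp add: V_def)
  have X_le: "norm (X k t) \<le> r t" if "t \<in> {0..T}" for k t
    using euler_polygon.norm_Phi_le[OF E that, of k] unfolding V_def[symmetric] X_def .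
  \<comment> \<open>With the final value \<open>r T\<close> as a uniform bound, increments of \<Psi>
    dominate those of every polygon, whatever the mesh.\<close>
  define \<Psi> where "\<Psi> t = r T * integral\<^sup>L (lebesgue_on {0..t}) (\<lambda>u. c u + \<Sigma> u)
      + integral\<^sup>L (lebesgue_on {0..t}) (\<lambda>u. d u + \<Sigma> u)" for t
  have \<Psi>_cont: "continuous_on {0..T} \<Psi>"
    unfolding \<Psi>_def by (intro continuous_intros continuous_on_indefinite_lebesgue_integral rate_int forcing_int)
  have equi_le: "norm (X k t - X k s) \<le> \<Psi> t - \<Psi> s" if st: "0 \<le> s" "s \<le> t" "t \<le> T" for k s t
  proof -
    have "norm (X k t - X k s) \<le> r T * integral\<^sup>L (lebesgue_on {s..t}) (\<lambda>u. c u + \<Sigma> u)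
      + integral\<^sup>L (lebesgue_on {s..t}) (\<lambda>u. d u + \<Sigma> u)"
      unfolding X_def V_def
    proof (rule euler_polygon.norm_Phi_diff_le[OF E st])
      fix u assume "u \<in> {0..t}"
      then show "norm (w k (idx (h k) u)) \<le> r T"
        using V_le[of u k] rT[of u] st by (simp add: V_def)
    qed
    also have "\<dots> = \<Psi> t - \<Psi> s"
      unfolding \<Psi>_def
      using integral_lebesgue_on_split[OF integrable_lebesgue_on_subinterval[OF rate_int, of 0 t], of s]
        integral_lebesgue_on_split[OF integrable_lebesgue_on_subinterval[OF forcing_int, of 0 t], of s] st
      by (simp add: algebra_simps)
    finally show ?thesis .
  qed
  have equi: "norm (X k t - X k s) \<le> \<bar>\<Psi> t - \<Psi> s\<bar>" if "s \<in> {0..T}" "t \<in> {0..T}" for k s t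
    using equi_le[of s t k] equi_le[of t s k] that by (cases "s \<le> t") (auto simp: norm_minus_commute)
  have X_le_T: "norm (X k t) \<le> r T" if "t \<in> {0..T}" for k t
    using X_le[OF that, of k] rT[OF that] by simp
  have "\<exists>\<kappa> y. strict_mono \<kappa> \<and> (\<forall>t\<in>{0..T}. (\<lambda>k. P (X (\<kappa> k) t)) \<longlonglongrightarrow> y t)"
    by (rule projected_subsequence[where X=X and B="r T" and \<Psi>=\<Psi>]) (fact X_le_T \<Psi>_cont equi)+
  then obtain \<kappa> y where \<kappa>: "strict_mono \<kappa>"
    and y: "\<forall>t\<in>{0..T}. (\<lambda>k. P (X (\<kappa> k) t)) \<longlonglongrightarrow> y t"
    by (elim exE conjE)
  note y = bspec[OF y]
  define u where "u j = V (\<kappa> j)" for j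
  have u_lim: "(\<lambda>j. u j t) \<longlonglongrightarrow> y t" if t: "t \<in> {0..T}" for t
  proof -
    define \<tau> where "\<tau> j = h (\<kappa> j) * real (idx (h (\<kappa> j)) t)" for j
    have \<tau>: "\<tau> j \<le> t" "t \<le> \<tau> j + h (\<kappa> j)" "0 \<le> \<tau> j" for j
      using idx_le[OF h, of t "\<kappa> j"] t h[of "\<kappa> j"] by (auto simp: \<tau>_def)
    have "h \<longlonglongrightarrow> 0" unfolding h_def using LIMSEQ_Suc[OF lim_1_over_n] by simp
    then have h0: "(\<lambda>j. h (\<kappa> j)) \<longlonglongrightarrow> 0" using LIMSEQ_subseq_LIMSEQ[OF _ \<kappa>] by (simp add: o_def)
    have "(\<lambda>j. \<tau> j - t) \<longlonglongrightarrow> 0"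
    proof (rule Lim_null_comparison[OF _ h0])
      show "\<forall>\<^sub>F j in sequentially. norm (\<tau> j - t) \<le> h (\<kappa> j)"
        using \<tau> by (auto simp: abs_le_iff algebra_simps intro!: always_eventually)
    qed
    then have "\<tau> \<longlonglongrightarrow> t" by (rule LIM_zero_cancel)
    moreover have "\<tau> j \<in> {0..T}" for j using \<tau>[of j] t by auto
    ultimately have "(\<lambda>j. \<Psi> (\<tau> j)) \<longlonglongrightarrow> \<Psi> t"
      by (intro continuous_on_tendsto_compose[OF \<Psi>_cont _ t] always_eventually) auto
    then have "(\<lambda>j. \<Psi> (\<tau> j) - \<Psi> t) \<longlonglongrightarrow> \<Psi> t - \<Psi> t" by (intro tendsto_intros)
    then have "(\<lambda>j. \<bar>\<Psi> (\<tau> j) - \<Psi> t\<bar>) \<longlonglongrightarrow> 0" by (intro tendsto_rabs_zero) simp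
    then have "(\<lambda>j. P (X (\<kappa> j) (\<tau> j)) - P (X (\<kappa> j) t)) \<longlonglongrightarrow> 0"
    proof (rule Lim_null_comparison[rotated], intro always_eventually allI)
      fix j
      have "norm (P (X (\<kappa> j) (\<tau> j)) - P (X (\<kappa> j) t)) = norm (P (X (\<kappa> j) (\<tau> j) - X (\<kappa> j) t))"
        by (simp add: linear_diff[OF bounded_linear.linear[OF bounded_linear_P]])
      also have "\<dots> \<le> norm (X (\<kappa> j) (\<tau> j) - X (\<kappa> j) t)" by (rule norm_P_le)
      also have "\<dots> \<le> \<bar>\<Psi> (\<tau> j) - \<Psi> t\<bar>" using \<tau>[of j] t by (intro equi) auto
      finally show "norm (P (X (\<kappa> j) (\<tau> j)) - P (X (\<kappa> j) t)) \<le> \<bar>\<Psi> (\<tau> j) - \<Psi> t\<bar>" .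
    qed
    from tendsto_add[OF this y[OF t]] have "(\<lambda>j. P (X (\<kappa> j) (\<tau> j))) \<longlonglongrightarrow> y t" by simp
    moreover have "u j t = P (X (\<kappa> j) (\<tau> j))" for j
      using fixp[OF t, of "\<kappa> j"] unfolding u_def X_def V_def \<tau>_def .
    ultimately show ?thesis by simp
  qed
  have u_le: "norm (u j t) \<le> r t" if "t \<in> {0..T}" for j t unfolding u_def by (rule V_le[OF that])
  have y_le: "norm (y t) \<le> r t" if "t \<in> {0..T}" for t
    by (rule LIMSEQ_le_const2[OF tendsto_norm[OF u_lim[OF that]]]) (use u_le[OF that] in blast)
  define a where "a j t = sel (u j t) t" for j t
  have a_meas: "a j \<in> borel_measurable (lebesgue_on {0..T})" for j
    unfolding a_def u_def V_def by (rule step_sel_meas)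
  have "AE t in lebesgue_on {0..T}. norm (a j t) \<le> c t * r t + d t" for j
    using euler_polygon.norm_sel_le[OF E, of "\<kappa> j"] unfolding a_def u_def V_def .
  then have a_le: "AE t in lebesgue_on {0..T}. \<forall>j. norm (a j t) \<le> c t * r t + d t"
    by (simp add: AE_all_countable)
  \<comment> \<open>The constant \<open>r T\<close> gives an evidently integrable majorant; the
    finer bound \<open>a_le\<close> is kept for the final velocity estimate.\<close>
  have a_dom: "AE t in lebesgue_on {0..T}. norm (a j t) \<le> c t * r T + d t" for j
    using a_le inT
  proof eventually_elim
    case (elim t)
    have "c t * r t \<le> c t * r T" using elim rT c_nn by (intro mult_left_mono) auto
    moreover have "norm (a j t) \<le> c t * r t + d t" using elim by blast
    ultimately show ?case by linarith
  qed
  have "integrable (lebesgue_on {0..T}) (\<lambda>t. c t * r T + d t)" using c_int d_int by simp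
  then have "\<exists>A \<mu> b. (\<forall>k. tail_weights k (A k) (\<mu> k)) \<and> b \<in> borel_measurable (lebesgue_on {0..T}) \<and>
      (AE t in lebesgue_on {0..T}. (\<lambda>k. \<Sum>j\<in>A k. \<mu> k j *\<^sub>R a j t) \<longlonglongrightarrow> b t)"
    by (rule dominated_convex_combinations_converge_AE[OF a_meas _ a_dom])
  then obtain A \<mu> b where wts: "\<forall>k. tail_weights k (A k) (\<mu> k)" and b_meas: "b \<in> borel_measurable (lebesgue_on {0..T})"
    and b_lim: "AE t in lebesgue_on {0..T}. (\<lambda>k. \<Sum>j\<in>A k. \<mu> k j *\<^sub>R a j t) \<longlonglongrightarrow> b t"
    by (elim exE conjE)
  note wts = spec[OF wts]
  have G_int: "integrable (lebesgue_on {0..T}) (G (u j))" for j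
    using euler_polygon.G_int[OF E, of "\<kappa> j"] unfolding u_def V_def .
  have "AE t in lebesgue_on {0..T}. integrable (lebesgue_on {0..t}) (\<lambda>s. g t s (u j s))" for j
    using euler_polygon.g_slice[OF E, of "\<kappa> j"] unfolding u_def V_def .
  then have "AE t in lebesgue_on {0..T}. \<forall>j. integrable (lebesgue_on {0..t}) (\<lambda>s. g t s (u j s))"
    by (simp add: AE_all_countable)
  with \<sigma>_slice inT have G_lim: "AE t in lebesgue_on {0..T}. (\<lambda>j. G (u j) t) \<longlonglongrightarrow> G y t \<and>
      integrable (lebesgue_on {0..t}) (\<lambda>s. g t s (y s))"
  proof eventually_elim
    case (elim t)
    have t: "0 \<le> t" "t \<le> T" using elim(2) by auto
    have gk: "integrable (lebesgue_on {0..t}) (\<lambda>s. g t s (u k s))" for k using elim(3) by (rule spec)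
    have le: "norm (u k s) \<le> r s" if "s \<in> {0..t}" for k s using u_le[of s k] that t by simp
    have lim: "(\<lambda>k. u k s) \<longlonglongrightarrow> y s" if "s \<in> {0..t}" for s using u_lim[of s] that t by simp
    show ?case
      using G_tendsto[OF t elim(1), of u y] gk le lim by blast
  qed
  \<comment> \<open>As a limit of measurable functions \<open>G'\<close> is measurable by
    construction, and it agrees with \<open>G y\<close> almost everywhere; it serves as the
    measurable version of the memory term.\<close>
  define G' where "G' t = lim (\<lambda>j. G (u j) t)" for t
  have G'_meas: "G' \<in> borel_measurable (lebesgue_on {0..T})"
    unfolding G'_def by (intro borel_measurable_lim_metric borel_measurable_integrable G_int)
  have G'_eq: "AE t in lebesgue_on {0..T}. G' t = G y t"
    using G_lim by eventually_elim (simp add: G'_def limI)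
  define f where "f t = b t + G' t" for t
  \<comment> \<open>The weights found for the selections are applied to the complete velocities. The
    memory terms already converge pointwise, so averaging leaves their limit unchanged.\<close>
  define S where "S k t = (\<Sum>j\<in>A k. \<mu> k j *\<^sub>R (a j t + G (u j) t))" for k t
  define W where "W t = r T * (c t + \<Sigma> t) + (d t + \<Sigma> t)" for t
  have W_int: "integrable (lebesgue_on {0..T}) W"
    unfolding W_def by (intro Bochner_Integration.integrable_add integrable_mult_right c_int d_int \<Sigma>_int)
  have vel_int: "integrable (lebesgue_on {0..T}) (\<lambda>t. a j t + G (u j) t)" for j
    using euler_polygon.velocity_int[OF E, of "\<kappa> j"] unfolding a_def u_def V_def .
  have S_int: "integrable (lebesgue_on {0..T}) (S k)" for k
    unfolding S_def by (intro Bochner_Integration.integrable_sum integrable_scaleR_right vel_int)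
  have "AE t in lebesgue_on {0..T}. norm (a j t + G (u j) t) \<le> W t" for j
    unfolding W_def a_def u_def V_def
  proof (rule euler_polygon.norm_velocity_le[OF E])
    fix s assume s: "s \<in> {0..T}"
    show "norm (w (\<kappa> j) (idx (h (\<kappa> j)) s)) \<le> r T"
      using V_le[OF s, of "\<kappa> j"] rT[OF s] by (simp add: V_def)
  qed (use T_pos in auto)
  then have vel_le: "AE t in lebesgue_on {0..T}. \<forall>j. norm (a j t + G (u j) t) \<le> W t"
    by (simp add: AE_all_countable)
  have S_le: "AE t in lebesgue_on {0..T}. norm (S k t) \<le> W t" for k
    using vel_le
  proof eventually_elim
    case (elim t)
    have "S k t \<in> cball 0 (W t)"
      unfolding S_def using wts[of k] by (rule tail_weights_convex) (use elim in auto)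
    then show ?case by simp
  qed
  have S_lim: "AE t in lebesgue_on {0..T}. (\<lambda>k. S k t) \<longlonglongrightarrow> f t"
    using b_lim G_lim G'_eq
  proof eventually_elim
    case (elim t)
    have "(\<lambda>k. \<Sum>j\<in>A k. \<mu> k j *\<^sub>R G (u j) t) \<longlonglongrightarrow> G' t"
      using elim by (intro tail_weights_tendsto[OF wts]) simp
    with elim(1) have "(\<lambda>k. (\<Sum>j\<in>A k. \<mu> k j *\<^sub>R a j t) + (\<Sum>j\<in>A k. \<mu> k j *\<^sub>R G (u j) t)) \<longlonglongrightarrow> b t + G' t"
      by (rule tendsto_add)
    then show ?case by (simp add: S_def f_def scaleR_add_right sum.distrib)
  qed
  have f_meas: "f \<in> borel_measurable (lebesgue_on {0..T})"
    unfolding f_def using b_meas G'_meas by (rule borel_measurable_add)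
  have f_int: "integrable (lebesgue_on {0..T}) f"
    by (rule integrable_dominated_convergence[OF f_meas borel_measurable_integrable[OF S_int] W_int S_lim S_le])
  define x where "x t = P x0 + integral\<^sup>L (lebesgue_on {0..t}) f" for t
  \<comment> \<open>The integral commutes with the finite averages and the weights sum to 1, so the
    averaged polygon is \<open>P x0\<close> plus the integral of \<open>S k\<close>; dominated
    convergence with majorant W applies.\<close>
  have comb_lim: "(\<lambda>k. \<Sum>j\<in>A k. \<mu> k j *\<^sub>R X (\<kappa> j) t) \<longlonglongrightarrow> x t" if t: "t \<in> {0..T}" for t
  proof -
    have sub: "integrable (lebesgue_on {0..t}) q" if "integrable (lebesgue_on {0..T}) q"
      for q :: "real \<Rightarrow> 'c::{banach, second_countable_topology}"
      using integrable_lebesgue_on_subinterval[OF that, of 0 t] t by simp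
    have subAE: "AE s in lebesgue_on {0..t}. Q s" if "AE s in lebesgue_on {0..T}. Q s" for Q
      using AE_lebesgue_on_subinterval[OF that, of 0 t] t by simp
    have "(\<lambda>k. integral\<^sup>L (lebesgue_on {0..t}) (S k)) \<longlonglongrightarrow> integral\<^sup>L (lebesgue_on {0..t}) f"
      by (rule integral_dominated_convergence[OF borel_measurable_integrable[OF sub[OF f_int]]
            borel_measurable_integrable[OF sub[OF S_int]] sub[OF W_int] subAE[OF S_lim] subAE[OF S_le]])
    then have "(\<lambda>k. P x0 + integral\<^sup>L (lebesgue_on {0..t}) (S k)) \<longlonglongrightarrow> x t"
      unfolding x_def by (intro tendsto_intros)
    moreover have "P x0 + integral\<^sup>L (lebesgue_on {0..t}) (S k) = (\<Sum>j\<in>A k. \<mu> k j *\<^sub>R X (\<kappa> j) t)" for k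
    proof -
      have Xeq: "X (\<kappa> j) t = P x0 + integral\<^sup>L (lebesgue_on {0..t}) (\<lambda>s. a j s + G (u j) s)" for j
        unfolding X_def Phi_def a_def u_def ..
      have "integral\<^sup>L (lebesgue_on {0..t}) (S k)
          = (\<Sum>j\<in>A k. \<mu> k j *\<^sub>R integral\<^sup>L (lebesgue_on {0..t}) (\<lambda>s. a j s + G (u j) s))"
        unfolding S_def using sub[OF vel_int]
        by (subst Bochner_Integration.integral_sum) (auto intro!: integrable_scaleR_right simp del: scaleR_add_right)
      moreover have "(\<Sum>j\<in>A k. \<mu> k j *\<^sub>R P x0) = P x0"
        using wts[of k] by (simp add: scaleR_sum_left[symmetric] tail_weights_def)
      ultimately show ?thesis unfolding Xeq by (simp add: scaleR_add_right sum.distrib)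
    qed
    ultimately show ?thesis by simp
  qed
  have x_le: "norm (x t) \<le> r t" if "t \<in> {0..T}" for t
    by (rule tail_weights_limit_norm_le[OF wts X_le[OF that] comb_lim[OF that]])
  \<comment> \<open>Linearity turns the projected average into the average of projected polygons.
    These converge to \<open>y t\<close> without averaging, so both limits coincide.\<close>
  have Px: "P (x t) = y t" if t: "t \<in> {0..T}" for t
  proof -
    have "(\<lambda>k. P (\<Sum>j\<in>A k. \<mu> k j *\<^sub>R X (\<kappa> j) t)) \<longlonglongrightarrow> P (x t)"
      by (rule bounded_linear.tendsto[OF bounded_linear_P comb_lim[OF t]])
    moreover have "P (\<Sum>j\<in>A k. \<mu> k j *\<^sub>R X (\<kappa> j) t) = (\<Sum>j\<in>A k. \<mu> k j *\<^sub>R P (X (\<kappa> j) t))" for k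
      using bounded_linear.linear[OF bounded_linear_P] by (simp add: linear_sum linear_cmul)
    moreover have "(\<lambda>k. \<Sum>j\<in>A k. \<mu> k j *\<^sub>R P (X (\<kappa> j) t)) \<longlonglongrightarrow> y t"
      by (rule tail_weights_tendsto[OF wts y[OF t]])
    ultimately show ?thesis using LIMSEQ_unique by simp
  qed
  have x0: "x 0 = P x0" by (simp add: x_def)
  have AC: "AC_on T x"
    unfolding AC_on_def using f_int x0 by (auto simp: x_def)
  have deriv: "AE t in lebesgue_on {0..T}. x differentiable (at t within {0..T}) \<and>
      vector_derivative x (at t within {0..T}) = f t"
    using indefinite_integral_has_vector_derivative_AE[OF f_int] inT
  proof eventually_elim
    case (elim t)
    have "(x has_vector_derivative 0 + f t) (at t within {0..T})"
      unfolding x_def by (intro has_vector_derivative_add has_vector_derivative_const elim(1))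
    then have "(x has_vector_derivative f t) (at t within {0..T})" by simp
    then show ?case
      using vector_derivative_within_cbox[of 0 T t x "f t"] T_pos elim(2)
      by (auto intro: differentiableI_vector)
  qed
  have b_mem: "AE t in lebesgue_on {0..T}. b t \<in> F t (y t)"
    using F2 b_lim inT
  proof eventually_elim
    case (elim t)
    show ?case
      by (rule limit_in_values[OF elim(3) elim(1) _ u_lim[OF elim(3)] wts elim(2)])
         (simp add: a_def sel_in[OF elim(3)])
  qed
  \<comment> \<open>Norm bounds survive convex combinations and limits, so the bound with
    \<open>r t\<close>, rather than \<open>r T\<close>, passes to b; this is the part of \<psi>
    coming from F.\<close>
  have b_le: "AE t in lebesgue_on {0..T}. norm (b t) \<le> c t * r t + d t"
    using a_le b_lim
  proof eventually_elim
    case (elim t)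
    then show ?case by (intro tail_weights_limit_norm_le[OF wts _ elim(2)]) blast
  qed
  have G_le: "AE t in lebesgue_on {0..T}. norm (G y t) \<le> \<Sigma> t + integral\<^sup>L (lebesgue_on {0..t}) (\<lambda>s. \<sigma> t s * r s)"
    using G_lim \<sigma>_slice inT
  proof eventually_elim
    case (elim t)
    then have t: "0 \<le> t" "t \<le> T" by auto
    have i: "integrable (lebesgue_on {0..t}) (\<lambda>s. \<sigma> t s * r s)" by (rule \<sigma>_r_int[OF t elim(2)])
    have "norm (G y t) \<le> integral\<^sup>L (lebesgue_on {0..t}) (\<lambda>s. \<sigma> t s * (1 + r s))"
      using elim i t y_le by (intro norm_G_le) (auto simp: distrib_left)
    also have "\<dots> = \<Sigma> t + integral\<^sup>L (lebesgue_on {0..t}) (\<lambda>s. \<sigma> t s * r s)"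
      using elim(2) i by (simp add: distrib_left inner_sigma_def)
    finally show ?case .
  qed
  have Gx: "integral\<^sup>L (lebesgue_on {0..t}) (\<lambda>s. g t s (P (x s))) = G y t" if "t \<in> {0..T}" for t
    unfolding G_def using that Px by (intro Bochner_Integration.integral_cong) auto
  have "AE t in lebesgue_on {0..T}.
          x differentiable (at t within {0..T}) \<and>
          vector_derivative x (at t within {0..T}) \<in>
            (\<lambda>w. w + integral\<^sup>L (lebesgue_on {0..t}) (\<lambda>s. g t s (P (x s)))) ` F t (P (x t))"
    using deriv b_mem G'_eq inT
    by eventually_elim (auto simp: f_def Gx Px)
  moreover have "AE t in lebesgue_on {0..T}.
          norm (vector_derivative x (at t within {0..T})) \<le> psi_fun (norm x0) c d \<sigma> t"
    using deriv b_le G_le G'_eq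
  proof eventually_elim
    case (elim t)
    then have "norm (vector_derivative x (at t within {0..T})) \<le> norm (b t) + norm (G y t)"
      by (simp add: f_def norm_triangle_ineq)
    with elim show ?case unfolding psi_fun_def by linarith
  qed
  ultimately show ?thesis using AC x0 x_le by blast
qed

end

section \<open>Complete inner product spaces as Banach spaces\<close>

text \<open>
  The sort \<open>{real_inner, complete_space}\<close> is not recognised as a subsort of \<open>banach\<close>, on which
  Bochner integration relies; an isometric copy of the type lies in both classes.
\<close>

typedef 'a copy = "UNIV :: 'a set" morphisms unwrap wrap by simp

lemma wrap_simps [simp]: "unwrap (wrap x) = x" "wrap (unwrap y) = y"
  by (simp_all add: wrap_inverse unwrap_inverse)

lemma wrap_image_eq: "wrap ` A = unwrap -` A"
  by (auto simp: image_iff) (metis wrap_simps(2))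

lemma range_wrap [simp]: "range wrap = UNIV"
  by (simp add: wrap_image_eq)

lemma copy_eq_iff: "x = y \<longleftrightarrow> unwrap x = unwrap y"
  by (simp add: unwrap_inject)

instantiation copy :: (real_inner) real_inner
begin

definition "0 = wrap 0"
definition "x + y = wrap (unwrap x + unwrap y)"
definition "x - y = wrap (unwrap x - unwrap y)"
definition "- x = wrap (- unwrap x)"
definition "a *\<^sub>R x = wrap (a *\<^sub>R unwrap x)"
definition "inner x y = unwrap x \<bullet> unwrap y"
definition "norm x = norm (unwrap x)"
definition "dist x y = dist (unwrap x) (unwrap y)"
definition "sgn x = wrap (sgn (unwrap x))"
definition "uniformity = (INF e\<in>{0 <..}. principal {(x :: 'a copy, y). dist x y < e})"
definition "open (U :: 'a copy set) \<longleftrightarrow> (\<forall>x\<in>U. eventually (\<lambda>(x', y). x' = x \<longrightarrow> y \<in> U) uniformity)"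

instance
proof
  fix x y z :: "'a copy" and a b :: real and U :: "'a copy set"
  show "x + y + z = x + (y + z)" "x + y = y + x" "0 + x = x" "- x + x = 0" "x - y = x + - y"
    "a *\<^sub>R (x + y) = a *\<^sub>R x + a *\<^sub>R y" "(a + b) *\<^sub>R x = a *\<^sub>R x + b *\<^sub>R x" "a *\<^sub>R b *\<^sub>R x = (a * b) *\<^sub>R x" "1 *\<^sub>R x = x"
    by (simp_all add: copy_eq_iff zero_copy_def plus_copy_def minus_copy_def uminus_copy_def scaleR_copy_def algebra_simps)
  show "dist x y = norm (x - y)" by (simp add: dist_copy_def norm_copy_def minus_copy_def dist_norm)
  show "sgn x = inverse (norm x) *\<^sub>R x" by (simp add: sgn_copy_def scaleR_copy_def norm_copy_def sgn_div_norm)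
  show "uniformity = (INF e\<in>{0 <..}. principal {(x :: 'a copy, y). dist x y < e})" by (rule uniformity_copy_def)
  show "open U \<longleftrightarrow> (\<forall>x\<in>U. eventually (\<lambda>(x', y). x' = x \<longrightarrow> y \<in> U) uniformity)" by (rule open_copy_def)
  show "x \<bullet> y = y \<bullet> x" by (simp add: inner_copy_def inner_commute)
  show "(x + y) \<bullet> z = x \<bullet> z + y \<bullet> z" by (simp add: inner_copy_def plus_copy_def inner_add_left)
  show "a *\<^sub>R x \<bullet> y = a * (x \<bullet> y)" by (simp add: inner_copy_def scaleR_copy_def)
  show "0 \<le> x \<bullet> x" by (simp add: inner_copy_def)
  show "x \<bullet> x = 0 \<longleftrightarrow> x = 0" by (simp add: inner_copy_def copy_eq_iff zero_copy_def)
  show "norm x = sqrt (x \<bullet> x)" by (simp add: inner_copy_def norm_copy_def norm_eq_sqrt_inner)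
qed

end

lemma bounded_linear_unwrap: "bounded_linear unwrap"
  by (rule bounded_linear_intro[of _ 1]) (simp_all add: plus_copy_def scaleR_copy_def norm_copy_def)

lemma bounded_linear_wrap: "bounded_linear wrap"
  by (rule bounded_linear_intro[of _ 1]) (simp_all add: plus_copy_def scaleR_copy_def norm_copy_def)

lemma unwrap_sum: "unwrap (\<Sum>i\<in>I. f i) = (\<Sum>i\<in>I. unwrap (f i))"
  by (rule linear_sum[OF bounded_linear.linear[OF bounded_linear_unwrap]])

lemma continuous_on_unwrap: "continuous_on A unwrap"
  by (rule linear_continuous_on[OF bounded_linear_unwrap])

lemma continuous_on_wrap: "continuous_on A wrap"
  by (rule linear_continuous_on[OF bounded_linear_wrap])

lemma open_wrap_image: "open U \<Longrightarrow> open (wrap ` U)"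
  unfolding wrap_image_eq using continuous_on_unwrap by (rule open_vimage[rotated])

instance copy :: ("{real_inner, complete_space}") banach
proof
  fix X :: "nat \<Rightarrow> 'a copy" assume "Cauchy X"
  then have "Cauchy (\<lambda>n. unwrap (X n))" by (simp add: Cauchy_def dist_copy_def)
  then obtain l where "(\<lambda>n. unwrap (X n)) \<longlonglongrightarrow> l" using Cauchy_convergent convergent_def by blast
  then have "(\<lambda>n. wrap (unwrap (X n))) \<longlonglongrightarrow> wrap l" by (rule bounded_linear.tendsto[OF bounded_linear_wrap])
  then show "convergent X" by (auto simp: convergent_def)
qed

text \<open>Images under \<open>wrap\<close> of a countable subbasis form one, since
  \<open>wrap\<close> is a homeomorphism and its images commute with intersections and
  unions.\<close>

instance copy :: ("{real_inner, second_countable_topology}") second_countable_topology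
proof
  obtain B :: "'a set set" where B: "countable B" "open = generate_topology B"
    using ex_countable_subbasis by auto
  let ?B = "(`) wrap ` B"
  have to: "generate_topology ?B (wrap ` U)" if "generate_topology B U" for U
    using that
  proof induction
    case UNIV
    have "wrap ` (UNIV :: 'a set) = UNIV" by (simp add: wrap_image_eq)
    then show ?case by (simp add: generate_topology.UNIV)
  next
    case (Int a b)
    then have "generate_topology ?B (wrap ` a \<inter> wrap ` b)" by (intro generate_topology.Int)
    then show ?case by (simp add: wrap_image_eq)
  next
    case (UN K)
    then have "generate_topology ?B (\<Union> ((`) wrap ` K))" by (intro generate_topology.UN) auto
    moreover have "\<Union> ((`) wrap ` K) = wrap ` \<Union> K" by auto
    ultimately show ?case by simp
  next
    case (Basis s)
    then show ?case by (intro generate_topology.Basis) auto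
  qed
  have "open U \<longleftrightarrow> generate_topology ?B U" for U :: "'a copy set"
  proof
    assume "open U"
    then have "open (wrap -` U)" using continuous_on_wrap by (rule open_vimage)
    then have "generate_topology ?B (wrap ` (wrap -` U))" unfolding B(2) by (rule to)
    then show "generate_topology ?B U" by simp
  next
    assume "generate_topology ?B U"
    then show "open U"
    proof induction
      case (Basis s)
      then obtain b where "b \<in> B" "s = wrap ` b" by auto
      moreover from this(1) have "open b" unfolding B(2) by (rule generate_topology.Basis)
      ultimately show ?case by (simp add: open_wrap_image)
    qed auto
  qed
  then show "\<exists>B :: 'a copy set set. countable B \<and> open = generate_topology B"
    using B(1) by (intro exI[of _ ?B]) (auto simp: fun_eq_iff)
qed

section \<open>Transport of integrals, derivatives, projections and hypotheses\<close>

lemma integral_wrap: "integral\<^sup>L M (\<lambda>s. wrap (f s)) = wrap (integral\<^sup>L M f)"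
  \<comment> \<open>Having a bounded linear inverse on the other side makes the exchange valid for
    every f, integrable or not.\<close>
  by (rule integral_bounded_linear'[OF bounded_linear_wrap bounded_linear_unwrap]) simp

lemma integral_unwrap: "integral\<^sup>L M (\<lambda>s. unwrap (f s)) = unwrap (integral\<^sup>L M f)"
  by (rule integral_bounded_linear'[OF bounded_linear_unwrap bounded_linear_wrap]) simp

lemma AC_on_unwrap:
  assumes "AC_on T x" shows "AC_on T (\<lambda>t. unwrap (x t))"
proof -
  obtain f where f: "integrable (lebesgue_on {0..T}) f" "\<forall>t\<in>{0..T}. x t = x 0 + integral\<^sup>L (lebesgue_on {0..t}) f"
    using assms by (auto simp: AC_on_def)
  show ?thesis
    unfolding AC_on_def
  proof (intro exI conjI ballI)
    show "integrable (lebesgue_on {0..T}) (\<lambda>t. unwrap (f t))"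
      by (rule integrable_bounded_linear[OF bounded_linear_unwrap f(1)])
    fix t assume "t \<in> {0..T}"
    then have "x t = x 0 + integral\<^sup>L (lebesgue_on {0..t}) f" using f(2) by blast
    then show "unwrap (x t) = unwrap (x 0) + integral\<^sup>L (lebesgue_on {0..t}) (\<lambda>t. unwrap (f t))"
      by (simp add: integral_unwrap plus_copy_def)
  qed
qed

lemma vector_derivative_unwrap:
  assumes "0 < T" "t \<in> {0..T}" "x differentiable (at t within {0..T})"
  shows "(\<lambda>t. unwrap (x t)) differentiable (at t within {0..T})"
    and "vector_derivative (\<lambda>t. unwrap (x t)) (at t within {0..T}) = unwrap (vector_derivative x (at t within {0..T}))"
proof -
  have "(x has_vector_derivative vector_derivative x (at t within {0..T})) (at t within {0..T})"
    using assms(3) by (simp add: vector_derivative_works)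
  then have d: "((\<lambda>t. unwrap (x t)) has_vector_derivative unwrap (vector_derivative x (at t within {0..T}))) (at t within {0..T})"
    by (rule bounded_linear.has_vector_derivative[OF bounded_linear_unwrap])
  then show "(\<lambda>t. unwrap (x t)) differentiable (at t within {0..T})" by (rule differentiableI_vector)
  show "vector_derivative (\<lambda>t. unwrap (x t)) (at t within {0..T}) = unwrap (vector_derivative x (at t within {0..T}))"
    using vector_derivative_within_cbox[of 0 T t] d assms by simp
qed

text \<open>The description operator needs existence and uniqueness. For uniqueness, the difference
  of two candidates lies in the span and is orthogonal to it, hence to itself.\<close>

lemma orth_proj_orthonormal:
  fixes e :: "nat \<Rightarrow> 'a::real_inner"
  assumes "finite I" and ortho: "\<And>i j. i \<in> I \<Longrightarrow> j \<in> I \<Longrightarrow> e i \<bullet> e j = (if i = j then 1 else 0)"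
  shows "orth_proj (span (e ` I)) v = (\<Sum>i\<in>I. (v \<bullet> e i) *\<^sub>R e i)"
  unfolding orth_proj_def
proof (rule the_equality)
  let ?y = "\<Sum>i\<in>I. (v \<bullet> e i) *\<^sub>R e i"
  have "?y \<in> span (e ` I)" by (intro span_sum span_scale span_base) auto
  moreover have "(v - ?y) \<bullet> z = 0" if "z \<in> span (e ` I)" for z
    using that
  proof (induction rule: span_induct)
    case base
    show ?case by (auto simp: subspace_def inner_add_right)
  next
    case (step z)
    then obtain j where j: "j \<in> I" "z = e j" by auto
    have "?y \<bullet> e j = (\<Sum>i\<in>I. if i = j then v \<bullet> e i else 0)"
      unfolding inner_sum_left using j by (intro sum.cong) (auto simp: ortho)
    then show ?case using j assms(1) by (simp add: inner_diff_left)
  qed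
  ultimately show *: "?y \<in> span (e ` I) \<and> (\<forall>z\<in>span (e ` I). (v - ?y) \<bullet> z = 0)" by blast
  fix y assume y: "y \<in> span (e ` I) \<and> (\<forall>z\<in>span (e ` I). (v - y) \<bullet> z = 0)"
  then have "y - ?y \<in> span (e ` I)" using * by (intro span_diff) auto
  then have "(v - y) \<bullet> (y - ?y) = 0" "(v - ?y) \<bullet> (y - ?y) = 0" using * y by blast+
  then have "(y - ?y) \<bullet> (y - ?y) = 0" by (simp add: inner_diff_left)
  then show "y = ?y" by simp
qed

text \<open>An open half-space is the preimage of an open ray under an inner product, hence a
  generator of the weak topology.\<close>

lemma usc_weak_halfspace:
  assumes "usc_weak G" "\<forall>w\<in>G v. w \<bullet> p < \<alpha>"
  shows "\<exists>\<delta>>0. \<forall>u. dist u v < \<delta> \<longrightarrow> (\<forall>w\<in>G u. w \<bullet> p < \<alpha>)"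
proof -
  have "openin weak_topology {x. x \<bullet> p \<in> {..<\<alpha>}}"
    unfolding weak_topology_def
    by (rule topology_generated_by_Basis, rule CollectI, intro exI[of _ p] exI[of _ "{..<\<alpha>}"]) simp
  moreover have "G v \<subseteq> {x. x \<bullet> p \<in> {..<\<alpha>}}" using assms(2) by auto
  ultimately obtain \<delta> where "\<delta> > 0" "\<forall>u. dist u v < \<delta> \<longrightarrow> G u \<subseteq> {x. x \<bullet> p \<in> {..<\<alpha>}}"
    using assms(1) unfolding usc_weak_def by blast
  then show ?thesis by (intro exI[of _ \<delta>]) auto
qed

text \<open>The ball of radius \<open>norm x + 1\<close> about the origin has x in its interior, so
  a Lipschitz bound there gives continuity at x.\<close>

lemma continuous_on_locally_lipschitz:
  fixes f :: "'a::real_normed_vector \<Rightarrow> 'b::real_normed_vector"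
  assumes "\<And>r. r > 0 \<Longrightarrow> \<exists>L\<ge>0. \<forall>x\<in>cball 0 r. \<forall>y\<in>cball 0 r. norm (f x - f y) \<le> L * norm (x - y)"
  shows "continuous_on UNIV f"
proof (rule continuous_at_imp_continuous_on, rule ballI)
  fix x :: 'a
  obtain L where "L \<ge> 0" and L: "\<And>u v. u \<in> cball 0 (norm x + 1) \<Longrightarrow> v \<in> cball 0 (norm x + 1) \<Longrightarrow> norm (f u - f v) \<le> L * norm (u - v)"
    using assms[of "norm x + 1"] by (auto simp: add_nonneg_pos)
  then have "L-lipschitz_on (cball 0 (norm x + 1)) f"
    by (intro lipschitz_onI) (auto simp: dist_norm)
  then have "continuous_on (cball 0 (norm x + 1)) f" by (rule lipschitz_on_continuous_on)
  moreover have "x \<in> interior (cball 0 (norm x + 1))" by (rule interiorI[of "ball 0 (norm x + 1)"]) auto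
  ultimately show "isCont f x" by (rule continuous_on_interior)
qed

theorem theorem4p1:
  fixes e :: "nat \<Rightarrow> 'a::{real_inner, complete_space, second_countable_topology}"
    and T :: real and x0 :: 'a
    and F :: "real \<Rightarrow> 'a \<Rightarrow> 'a set"
    and c d :: "real \<Rightarrow> real"
    and g :: "real \<Rightarrow> real \<Rightarrow> 'a \<Rightarrow> 'a"
    and \<sigma> :: "real \<Rightarrow> real \<Rightarrow> real"
    and P :: "nat \<Rightarrow> 'a \<Rightarrow> 'a"
    and D :: "(real \<times> real) set"
  assumes ortho: "\<forall>i\<ge>1. \<forall>j\<ge>1. e i \<bullet> e j = (if i = j then 1 else 0)"
    and basis: "closure (span (e ` {1..})) = UNIV"
    and P_def: "\<forall>n. P n = orth_proj (span (e ` {1..n}))"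
    and T_pos: "T > 0"
    and F_ne: "\<forall>t\<in>{0..T}. \<forall>v. F t v \<noteq> {}"
    and F_closed: "\<forall>t\<in>{0..T}. \<forall>v. closed (F t v)"
    and F_convex: "\<forall>t\<in>{0..T}. \<forall>v. convex (F t v)"
    and F1: "\<forall>v. measurable_multifun (lebesgue_on {0..T}) (\<lambda>t. F t v)"
    and F2: "AE t in lebesgue_on {0..T}. usc_weak (F t)"
    and c_int: "integrable (lebesgue_on {0..T}) c" and c_nn: "\<forall>t\<in>{0..T}. c t \<ge> 0"
    and d_int: "integrable (lebesgue_on {0..T}) d" and d_nn: "\<forall>t\<in>{0..T}. d t \<ge> 0"
    and F3: "AE t in lebesgue_on {0..T}. \<forall>v. Inf (norm ` F t v) \<le> c t * norm v + d t"
    and D_def: "D = {(t, s). t \<in> {0..T} \<and> s \<in> {0..T} \<and> s \<le> t}"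
    and g1: "\<forall>v. (\<lambda>(t, s). g t s v) \<in> borel_measurable (lebesgue_on ({0..T} \<times> {0..T}))"
    and g2: "\<forall>r>0. \<exists>\<mu>. integrable (lebesgue_on {0..T}) \<mu> \<and> (\<forall>t\<in>{0..T}. \<mu> t \<ge> 0) \<and>
               (\<forall>(t, s)\<in>D. \<forall>x\<in>cball 0 r. \<forall>y\<in>cball 0 r.
                   norm (g t s x - g t s y) \<le> \<mu> t * norm (x - y))"
    and \<sigma>_int: "integrable (lebesgue_on D) (\<lambda>(t, s). \<sigma> t s)"
    and \<sigma>_nn: "\<forall>(t, s)\<in>D. \<sigma> t s \<ge> 0"
    and g3: "\<forall>(t, s)\<in>D. \<forall>x. norm (g t s x) \<le> \<sigma> t s * (1 + norm x)"
  shows "\<forall>n. \<exists>x :: real \<Rightarrow> 'a.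
           AC_on T x \<and> x 0 = P n x0 \<and>
           (AE t in lebesgue_on {0..T}.
              x differentiable (at t within {0..T}) \<and>
              vector_derivative x (at t within {0..T}) \<in>
                (\<lambda>w. w + integral\<^sup>L (lebesgue_on {0..t}) (\<lambda>s. g t s (P n (x s)))) ` F t (P n (x t))) \<and>
           (\<forall>t\<in>{0..T}. norm (x t) \<le> r_fun (norm x0) c d \<sigma> t) \<and>
           (AE t in lebesgue_on {0..T}.
              norm (vector_derivative x (at t within {0..T})) \<le> psi_fun (norm x0) c d \<sigma> t)"
proof
  fix n
  let ?F = "\<lambda>t v. wrap ` F t (unwrap v)" and ?g = "\<lambda>t s v. wrap (g t s (unwrap v))" and ?e = "\<lambda>i. wrap (e i)"
  have D_eq: "D = {(t, s). 0 \<le> s \<and> s \<le> t \<and> t \<le> T}"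
    unfolding D_def by auto
  have D: "(t, s) \<in> D" if "0 \<le> s" "s \<le> t" "t \<le> T" for t s
    using that by (simp add: D_eq)
  \<comment> \<open>Basis, multifunction and kernel are conjugated by the isometry. Norms, distances
    and inner products do not change, so c, d and \<sigma> are carried over as they are.\<close>
  interpret C: projected_inclusion T "wrap x0" c d \<sigma> ?e n ?F ?g
  proof
    show "0 < T" "0 \<le> norm (wrap x0)" using T_pos by auto
    show "integrable (lebesgue_on {0..T}) c" "integrable (lebesgue_on {0..T}) d" by fact+
    show "0 \<le> c t" "0 \<le> d t" if "t \<in> {0..T}" for t using c_nn d_nn that by auto
    show "integrable (lebesgue_on {(t, s). 0 \<le> s \<and> s \<le> t \<and> t \<le> T}) (\<lambda>(t, s). \<sigma> t s)"
      using \<sigma>_int unfolding D_eq .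
    show "0 \<le> \<sigma> t s" if "0 \<le> s" "s \<le> t" "t \<le> T" for t s
      using bspec[OF \<sigma>_nn D[OF that]] by simp
    show "wrap (e i) \<bullet> wrap (e j) = (if i = j then 1 else 0)" if "i \<in> {1..n}" "j \<in> {1..n}" for i j
      using ortho that by (simp add: inner_copy_def)
    show "wrap ` F t (unwrap v) \<noteq> {}" "closed (wrap ` F t (unwrap v))" "convex (wrap ` F t (unwrap v))"
      if "t \<in> {0..T}" for t v
    proof -
      show "wrap ` F t (unwrap v) \<noteq> {}" using F_ne that by simp
      have "closed (F t (unwrap v))" using F_closed that by blast
      then show "closed (wrap ` F t (unwrap v))"
        unfolding wrap_image_eq using continuous_on_unwrap by (rule closed_vimage)
      show "convex (wrap ` F t (unwrap v))"
        using F_convex that by (intro convex_linear_image bounded_linear.linear[OF bounded_linear_wrap]) blast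
    qed
    show "{t \<in> {0..T}. wrap ` F t (unwrap v) \<inter> ball p \<rho> \<noteq> {}} \<in> sets (lebesgue_on {0..T})" for v p \<rho>
    proof -
      have "wrap ` F t (unwrap v) \<inter> ball p \<rho> \<noteq> {} \<longleftrightarrow> F t (unwrap v) \<inter> ball (unwrap p) \<rho> \<noteq> {}" for t
        by (auto simp: dist_copy_def)
      moreover have "{t \<in> space (lebesgue_on {0..T}). F t (unwrap v) \<inter> ball (unwrap p) \<rho> \<noteq> {}} \<in> sets (lebesgue_on {0..T})"
        using F1 unfolding measurable_multifun_def by blast
      ultimately show ?thesis by simp
    qed
    show "AE t in lebesgue_on {0..T}. \<forall>v p \<alpha>. (\<forall>w\<in>wrap ` F t (unwrap v). w \<bullet> p < \<alpha>) \<longrightarrow>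
        (\<exists>\<delta>>0. \<forall>u. dist u v < \<delta> \<longrightarrow> (\<forall>w\<in>wrap ` F t (unwrap u). w \<bullet> p < \<alpha>))"
      using F2
    proof eventually_elim
      case (elim t)
      show ?case
      proof (intro allI impI)
        fix v p \<alpha> assume "\<forall>w\<in>wrap ` F t (unwrap v). w \<bullet> p < \<alpha>"
        then have "\<forall>w\<in>F t (unwrap v). w \<bullet> unwrap p < \<alpha>" by (simp add: inner_copy_def)
        from usc_weak_halfspace[OF elim this]
        show "\<exists>\<delta>>0. \<forall>u. dist u v < \<delta> \<longrightarrow> (\<forall>w\<in>wrap ` F t (unwrap u). w \<bullet> p < \<alpha>)"
          by (simp add: inner_copy_def dist_copy_def) blast
      qed
    qed
    show "AE t in lebesgue_on {0..T}. \<forall>v. Inf (norm ` wrap ` F t (unwrap v)) \<le> c t * norm v + d t"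
      using F3 by eventually_elim (simp add: image_image norm_copy_def)
    show "(\<lambda>(t, s). wrap (g t s (unwrap v))) \<in> borel_measurable (lebesgue_on ({0..T} \<times> {0..T}))" for v
    proof -
      have "wrap \<in> borel_measurable borel" by (intro borel_measurable_continuous_onI continuous_on_wrap)
      with spec[OF g1, of "unwrap v"] have "(\<lambda>p. wrap (case p of (t, s) \<Rightarrow> g t s (unwrap v))) \<in> borel_measurable (lebesgue_on ({0..T} \<times> {0..T}))"
        by (rule measurable_compose)
      then show ?thesis by (simp add: case_prod_beta')
    qed
    show "continuous_on UNIV (\<lambda>v. wrap (g t s (unwrap v)))" if ts: "0 \<le> s" "s \<le> t" "t \<le> T" for t s
    proof -
      have "continuous_on UNIV (g t s)"
      proof (rule continuous_on_locally_lipschitz)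
        fix r :: real assume "r > 0"
        then obtain \<mu> where "\<forall>t\<in>{0..T}. \<mu> t \<ge> 0"
          "\<forall>(t, s)\<in>D. \<forall>x\<in>cball 0 r. \<forall>y\<in>cball 0 r. norm (g t s x - g t s y) \<le> \<mu> t * norm (x - y)"
          using g2 by blast
        then show "\<exists>L\<ge>0. \<forall>x\<in>cball 0 r. \<forall>y\<in>cball 0 r. norm (g t s x - g t s y) \<le> L * norm (x - y)"
          \<comment> \<open>With t and s fixed, the number \<open>\<mu> t\<close> is the Lipschitz
            constant on this ball.\<close>
          using D[OF ts] ts by (intro exI[of _ "\<mu> t"]) auto
      qed
      then have "continuous_on UNIV (\<lambda>v. g t s (unwrap v))"
        by (rule continuous_on_compose2[OF _ continuous_on_unwrap]) simp
      then show ?thesis by (rule continuous_on_compose2[OF continuous_on_wrap[of UNIV]]) simp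
    qed
    show "norm (wrap (g t s (unwrap x))) \<le> \<sigma> t s * (1 + norm x)" if "0 \<le> s" "s \<le> t" "t \<le> T" for t s x
      using bspec[OF g3 D[OF that]] by (simp add: norm_copy_def)
  qed
  \<comment> \<open>Here the projection defined by orthogonality meets the coordinate formula used
    in the construction.\<close>
  have P_eq: "P n (unwrap v) = unwrap (C.P v)" for v
  proof -
    have "P n (unwrap v) = (\<Sum>i\<in>{1..n}. (unwrap v \<bullet> e i) *\<^sub>R e i)"
      unfolding P_def[rule_format] using ortho by (intro orth_proj_orthonormal) auto
    also have "\<dots> = unwrap (C.P v)"
      by (simp add: C.P_def unwrap_sum scaleR_copy_def inner_copy_def)
    finally show ?thesis .
  qed
  have norm_x0: "norm (wrap x0) = norm x0" by (simp add: norm_copy_def)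
  obtain x where x: "AC_on T x" "x 0 = C.P (wrap x0)"
    and incl: "AE t in lebesgue_on {0..T}. x differentiable (at t within {0..T}) \<and>
          vector_derivative x (at t within {0..T}) \<in>
            (\<lambda>w. w + integral\<^sup>L (lebesgue_on {0..t}) (\<lambda>s. ?g t s (C.P (x s)))) ` ?F t (C.P (x t))"
    and r: "\<forall>t\<in>{0..T}. norm (x t) \<le> r_fun (norm x0) c d \<sigma> t"
    and psi: "AE t in lebesgue_on {0..T}. norm (vector_derivative x (at t within {0..T})) \<le> psi_fun (norm x0) c d \<sigma> t"
    using C.solution_exists unfolding norm_x0 by (elim exE conjE)
  have inT: "AE t in lebesgue_on {0..T}. t \<in> {0..T}" by (intro AE_I2) simp
  let ?x = "\<lambda>t. unwrap (x t)"
  have "AE t in lebesgue_on {0..T}. ?x differentiable (at t within {0..T}) \<and>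
      vector_derivative ?x (at t within {0..T}) \<in>
        (\<lambda>w. w + integral\<^sup>L (lebesgue_on {0..t}) (\<lambda>s. g t s (P n (?x s)))) ` F t (P n (?x t))"
    using incl inT
  proof eventually_elim
    case (elim t)
    note dx = vector_derivative_unwrap[OF T_pos elim(2) conjunct1[OF elim(1)]]
    obtain z where z: "z \<in> F t (unwrap (C.P (x t)))" "vector_derivative x (at t within {0..T})
        = wrap z + integral\<^sup>L (lebesgue_on {0..t}) (\<lambda>s. ?g t s (C.P (x s)))"
      using elim(1) by auto
    have "vector_derivative ?x (at t within {0..T}) = z + integral\<^sup>L (lebesgue_on {0..t}) (\<lambda>s. g t s (P n (?x s)))"
      unfolding dx(2) z(2) integral_wrap P_eq by (simp add: plus_copy_def)
    then show ?case using dx(1) z(1) by (auto simp: P_eq)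
  qed
  moreover have "AE t in lebesgue_on {0..T}.
      norm (vector_derivative ?x (at t within {0..T})) \<le> psi_fun (norm x0) c d \<sigma> t"
    using incl psi inT
  proof eventually_elim
    case (elim t)
    then show ?case
      using vector_derivative_unwrap(2)[OF T_pos elim(3) conjunct1[OF elim(1)]] by (simp add: norm_copy_def)
  qed
  moreover have "?x 0 = P n x0" using x(2) P_eq[of "wrap x0"] by simp
  moreover have "\<forall>t\<in>{0..T}. norm (?x t) \<le> r_fun (norm x0) c d \<sigma> t" using r by (simp add: norm_copy_def)
  moreover have "AC_on T ?x" by (rule AC_on_unwrap[OF x(1)])
  ultimately show "\<exists>x :: real \<Rightarrow> 'a.
           AC_on T x \<and> x 0 = P n x0 \<and>
           (AE t in lebesgue_on {0..T}.
              x differentiable (at t within {0..T}) \<and>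
              vector_derivative x (at t within {0..T}) \<in>
                (\<lambda>w. w + integral\<^sup>L (lebesgue_on {0..t}) (\<lambda>s. g t s (P n (x s)))) ` F t (P n (x t))) \<and>
           (\<forall>t\<in>{0..T}. norm (x t) \<le> r_fun (norm x0) c d \<sigma> t) \<and>
           (AE t in lebesgue_on {0..T}.
              norm (vector_derivative x (at t within {0..T})) \<le> psi_fun (norm x0) c d \<sigma> t)"
    by (intro exI[of _ ?x] conjI)
qed

end
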